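(* Suppose that $P(Z_1>x)\sim x^{-\beta}L(x)$ as $x\to+\infty$ for some $1<\beta<2$, and that either $\gamma<\beta-1$ or $E[Z_1^{1+\gamma}]<\infty$. Then for every $\epsilon>0$, $$\lim_{n\to\infty}m^{\gamma n}P\left(\left|\frac{Z_{n+1}}{Z_n}-m\right|\ge\epsilon\right)=\sum_{k\ge1}q_k\,\phi(k,\epsilon),$$ where $\phi(k,\epsilon)=P\left(\left|\frac1k\sum_{i=1}^k\xi_i-m\right|\ge\epsilon\right)$ and $(\xi_i)_{i\ge1}$ are i.i.d. random variables with the same distribution as $Z_1$.
   Context: $(Z_n)_{n\ge0}$ is a Galton-Watson process with $Z_0=1$ and offspring distribution $\{p_k\}_{k\ge0}$ such that $p_0=0$, $0<p_1<1$, with finite mean $m=\sum_{k\ge1}kp_k>1$ and $E[Z_1\log Z_1]<\infty$. The Schröder constant $\gamma>0$ is defined by $p_1=m^{-\gamma}$. For $k\ge1$, $q_k=\lim_{n\to\infty}P(Z_n=k)\,m^{\gamma n}$ (these limits exist). $L$ is a (positive) slowly varying function. Standing assumption on the norming function: let $X_1,X_2,\dots$ be i.i.d. copies of $Z_1-m$ and $S_k=X_1+\cdots+X_k$. Then $X_1$ is in the domain of attraction of a $\beta$-stable law: $b(k)^{-1}S_k$ converges in distribution to a strictly $\beta$-stable random variable, where $b:[0,\infty)\to[0,\infty)$ is continuous, increasing and onto, $b(0)=0$, $b(x)=x^{1/\beta}s(x)$ for $x>0$ with $s$ slowly varying. It is assumed that $\liminf_{x\to+\infty}s(x)\in(0,+\infty]$.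 *)

theory Defs
  imports "HOL-Probability.Probability" "HOL-Library.Landau_Symbols"
begin

text \<open>
  \<open>\<xi> n i\<close> is the number of children of the \<open>i\<close>-th individual of generation \<open>n\<close>.
\<close>

locale galton_watson = prob_space M
  for M :: "'a measure" +
  fixes p :: "nat pmf" and \<xi> :: "nat \<Rightarrow> nat \<Rightarrow> 'a \<Rightarrow> nat" and Z :: "nat \<Rightarrow> 'a \<Rightarrow> nat"
  assumes indep_offspring:
      "indep_vars (\<lambda>_. count_space UNIV) (\<lambda>(n, i). \<xi> n i) (UNIV :: (nat \<times> nat) set)"
    and distr_offspring: "distr M (count_space UNIV) (\<xi> n i) = measure_pmf p"
    and Z_0: "\<omega> \<in> space M \<Longrightarrow> Z 0 \<omega> = 1"
    and Z_Suc: "\<omega> \<in> space M \<Longrightarrow> Z (Suc n) \<omega> = (\<Sum>i<Z n \<omega>. \<xi> n i \<omega>)"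

definition offspring_mean :: "nat pmf \<Rightarrow> real" where
  "offspring_mean p = measure_pmf.expectation p real"

text \<open>
  Positive slowly varying functions on \<open>(0, \<infinity>)\<close> in the sense of Karamata; values at
  arguments \<open>x \<le> 0\<close> are irrelevant.
\<close>

definition slowly_varying :: "(real \<Rightarrow> real) \<Rightarrow> bool" where
  "slowly_varying f \<longleftrightarrow>
     (\<forall>x>0. 0 < f x) \<and> set_borel_measurable borel {0<..} f \<and>
     (\<forall>c>0. ((\<lambda>x. f (c * x) / f x) \<longlongrightarrow> 1) at_top)"

text \<open>
  A law \<open>\<nu>\<close> is strictly \<open>\<alpha>\<close>-stable if \<open>Y\<^sub>1 + \<dots> + Y\<^sub>n\<close> has the law of \<open>n\<^bsup>1/\<alpha>\<^esup> Y\<^sub>1\<close>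
  for i.i.d. \<open>Y\<^sub>i\<close> with law \<open>\<nu>\<close>.  As usual for domains of attraction, point masses are
  excluded.
\<close>

definition strictly_stable :: "real \<Rightarrow> real measure \<Rightarrow> bool" where
  "strictly_stable \<alpha> \<nu> \<longleftrightarrow>
     real_distribution \<nu> \<and> (\<forall>c. \<nu> \<noteq> return borel c) \<and>
     (\<forall>n\<ge>1. distr (\<Pi>\<^sub>M i\<in>{1..n}. \<nu>) borel (\<lambda>y. \<Sum>i=1..n. y i)
            = distr \<nu> borel (\<lambda>y. real n powr (1 / \<alpha>) * y))"

text \<open>The coordinates on this space are i.i.d. with law \<open>p\<close>.\<close>

definition iid_space :: "nat pmf \<Rightarrow> (nat \<Rightarrow> nat) measure" where
  "iid_space p = (\<Pi>\<^sub>M i\<in>UNIV. measure_pmf p)"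

definition normed_centered_sum_law :: "nat pmf \<Rightarrow> (real \<Rightarrow> real) \<Rightarrow> nat \<Rightarrow> real measure" where
  "normed_centered_sum_law p b k =
     distr (iid_space p) borel
       (\<lambda>x. (\<Sum>i=1..k. real (x i) - offspring_mean p) / b (real k))"

definition \<phi> :: "nat pmf \<Rightarrow> nat \<Rightarrow> real \<Rightarrow> real" where
  "\<phi> p k \<epsilon> = measure (iid_space p)
     {x \<in> space (iid_space p).
        \<bar>1 / real k * (\<Sum>i=1..k. real (x i)) - offspring_mean p\<bar> \<ge> \<epsilon>}"

text \<open>
  The limit exists because \<open>m\<^bsup>\<gamma>\<^esup> = 1 / p\<^sub>1\<close> and \<open>p\<^sub>0 = 0\<close>: the sequence is then
  nondecreasing (condition on \<open>Z\<^sub>1 = 1\<close>) and bounded.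
\<close>

definition q_limit ::
    "'a measure \<Rightarrow> nat pmf \<Rightarrow> (nat \<Rightarrow> 'a \<Rightarrow> nat) \<Rightarrow> real \<Rightarrow> nat \<Rightarrow> real" where
  "q_limit M p Z \<gamma> k =
     lim (\<lambda>n. measure M {\<omega> \<in> space M. Z n \<omega> = k} * offspring_mean p powr (\<gamma> * real n))"

end

theory Submission
  imports Defs
begin

text \<open>
  Write \<open>f\<close> for the offspring generating function and \<open>a\<^sub>n(k) = m\<^bsup>\<gamma>n\<^esup> P(Z\<^sub>n = k)\<close>.  Conditioning on
  \<open>Z\<^sub>n\<close> turns the quantity of interest into \<open>\<Sum>\<^sub>k a\<^sub>n(k) \<phi>(k, \<epsilon>)\<close>, and \<open>a\<^sub>n(k)\<close> is nondecreasing in \<open>n\<close>.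
  So everything follows from monotone convergence once these sums are bounded uniformly in \<open>n\<close>.
  The tail hypothesis is used only through \<open>P(Z\<^sub>1 > 2x) / P(Z\<^sub>1 > x) \<longrightarrow> 2\<^bsup>-\<beta>\<^esup>\<close>: in both cases of the
  moment hypothesis this yields \<open>\<gamma> < 1\<close> and \<open>E[Z\<^sub>1\<^bsup>1+\<gamma>\<^esup>] < \<infinity>\<close>.

  Uniform bound: the function \<open>v(s) = (1 - s)\<^bsup>-\<gamma>\<^esup>\<close> satisfies \<open>v(f(s)) \<le> p\<^sub>1 (v(s) + C)\<close>, so about
  \<open>log\<^sub>m x\<close> iterations of \<open>f\<close> bring \<open>1 - 1/(2x)\<close> below a fixed \<open>s\<^sub>0 < 1\<close>, from where the iterates decay
  like \<open>p\<^sub>1\<^sup>n\<close>.  This gives \<open>\<Sum>\<^bsub>k\<le>x\<^esub> a\<^sub>n(k) \<le> C x\<^bsup>\<gamma>\<^esup>\<close>.  Truncating the summands at level \<open>k\<close> and applying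
  Chebyshev's inequality gives \<open>\<phi>(k, \<epsilon>) \<le> C E[min(k, Z\<^sub>1\<^sup>2/k)]\<close> for large \<open>k\<close>, and a dyadic decomposition
  gives \<open>\<Sum>\<^sub>k a\<^sub>n(k) min(k, x\<^sup>2/k) \<le> C x\<^bsup>1+\<gamma>\<^esup>\<close> because \<open>\<gamma> < 1\<close>.
\<close>

section \<open>Iterates of the generating function\<close>

definition pgf :: "nat pmf \<Rightarrow> real \<Rightarrow> real" where
  "pgf p s = measure_pmf.expectation p (\<lambda>k. s ^ k)"

lemma integrable_pgf: "0 \<le> s \<Longrightarrow> s \<le> 1 \<Longrightarrow> integrable (measure_pmf p) (\<lambda>k. s ^ k :: real)"
  by (rule measure_pmf.integrable_const_bound[where B = 1]) (auto simp: power_le_one)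

lemma pgf_nonneg: "0 \<le> s \<Longrightarrow> 0 \<le> pgf p s"
  unfolding pgf_def by (rule Bochner_Integration.integral_nonneg) auto

lemma pgf_mono:
  assumes "0 \<le> s" "s \<le> t" "t \<le> 1"
  shows "pgf p s \<le> pgf p t"
  unfolding pgf_def using assms
  by (intro integral_mono integrable_pgf) (auto intro: power_mono)

lemma integrable_indicator_pmf: "integrable (measure_pmf p) (indicator A :: _ \<Rightarrow> real)"
  by (rule measure_pmf.integrable_const_bound[where B = 1]) (auto simp: indicator_def)

text \<open>Since \<open>pmf p 0 = 0\<close>, every offspring number in the support other than 1 is
  at least 2, and there \<open>s ^ k\<close> is at most \<open>s\<^sup>2\<close>. Keeping the atom
  at 1 exact preserves the slope \<open>pmf p 1\<close> of the generating function at 0, which is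
  the decay rate wanted for its iterates. The pointwise bound fails at \<open>k = 0\<close>, so it
  is only claimed on the support.\<close>

lemma pgf_le_quadratic:
  assumes p0: "pmf p 0 = 0" and s: "0 \<le> s" "s \<le> 1"
  shows "pgf p s \<le> s * (pmf p 1 + (1 - pmf p 1) * s)"
proof -
  have "pgf p s \<le> measure_pmf.expectation p (\<lambda>k. s\<^sup>2 + (s - s\<^sup>2) * indicator {1} k)"
    unfolding pgf_def
  proof (rule integral_mono_AE)
    have "s ^ k \<le> s\<^sup>2 + (s - s\<^sup>2) * indicator {1} k" if "k \<in> set_pmf p" for k
    proof (cases "k = 1")
      case False
      with that p0 have "2 \<le> k" by (cases k) (auto simp: set_pmf_iff)
      then show ?thesis using False s by (auto intro: power_decreasing)
    qed auto
    then show "AE k in measure_pmf p. s ^ k \<le> s\<^sup>2 + (s - s\<^sup>2) * indicator {1} k"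
      by (simp add: AE_measure_pmf_iff)
    show "integrable (measure_pmf p) (\<lambda>k. s\<^sup>2 + (s - s\<^sup>2) * indicator {1} k)"
      by (intro Bochner_Integration.integrable_add integrable_mult_right integrable_indicator_pmf)
         auto
  qed (use s integrable_pgf in auto)
  also have "\<dots> = s\<^sup>2 + (s - s\<^sup>2) * pmf p 1"
    by (subst Bochner_Integration.integral_add)
       (auto simp: measure_pmf_single integrable_indicator_pmf)
  also have "\<dots> = s * (pmf p 1 + (1 - pmf p 1) * s)"
    by (simp add: algebra_simps power2_eq_square)
  finally show ?thesis .
qed

lemma pgf_le_self:
  assumes "pmf p 0 = 0" "0 \<le> s" "s \<le> 1"
  shows "pgf p s \<le> s"
proof -
  have "pmf p 1 + (1 - pmf p 1) * s \<le> pmf p 1 + (1 - pmf p 1) * 1"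
    using assms pmf_le_1[of p 1] by (intro add_left_mono mult_left_mono) auto
  then have "s * (pmf p 1 + (1 - pmf p 1) * s) \<le> s * 1"
    using assms by (intro mult_left_mono) auto
  with pgf_le_quadratic[OF assms] show ?thesis by simp
qed

lemma power_powr_commute: "0 < a \<Longrightarrow> (a ^ i) powr r = (a powr r) ^ i" for a r :: real
  by (simp add: powr_realpow[symmetric] powr_powr mult.commute)

lemma pgf_iter_bounds:
  assumes "pmf p 0 = 0" "0 \<le> s" "s \<le> 1"
  shows "0 \<le> (pgf p ^^ n) s" "(pgf p ^^ n) s \<le> s"
  using assms
  by (induction n) (auto intro: pgf_nonneg pgf_le_self order_trans)

lemma pgf_iter_mono:
  assumes "pmf p 0 = 0" "0 \<le> s" "s \<le> t" "t \<le> 1"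
  shows "(pgf p ^^ n) s \<le> (pgf p ^^ n) t"
proof (induction n)
  case (Suc n)
  show ?case
    using assms pgf_iter_bounds[of p s n] pgf_iter_bounds[of p t n] Suc
    by (auto intro!: pgf_mono)
qed (use assms in auto)

text \<open>The rate is found in two rounds. A crude geometric bound comes first; it makes the
  iterates summable, so that the correction factors \<open>1 + D * (pgf p ^^ i) s\<close> separating
  the n-th iterate from a multiple of \<open>pmf p 1 ^ n\<close> have a bounded product.\<close>

lemma pgf_iter_decay:
  assumes p0: "pmf p 0 = 0" and p1: "0 < pmf p 1" "pmf p 1 < 1" and s: "0 \<le> s" "s < 1"
  shows "\<exists>B>0. \<forall>n. (pgf p ^^ n) s \<le> B * pmf p 1 ^ n"
proof -
  \<comment> \<open>The quadratic bound gives \<open>pgf p t \<le> t * \<rho>\<close> for every t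
    between 0 and s, hence along the whole orbit of s.\<close>
  define \<rho> where "\<rho> = pmf p 1 + (1 - pmf p 1) * s"
  \<comment> \<open>Chosen so that the factor \<open>pmf p 1 + (1 - pmf p 1) * t\<close> equals
    \<open>pmf p 1 * (1 + D * t)\<close>.\<close>
  define D where "D = (1 - pmf p 1) / pmf p 1"
  have \<rho>: "0 \<le> \<rho>" "\<rho> < 1"
  proof -
    show "0 \<le> \<rho>" using p1 s by (auto simp: \<rho>_def)
    have "(1 - pmf p 1) * s < (1 - pmf p 1) * 1" using p1 s by (intro mult_strict_left_mono) auto
    then show "\<rho> < 1" by (simp add: \<rho>_def)
  qed
  have D: "D \<ge> 0" using p1 by (auto simp: D_def)
  note bds = pgf_iter_bounds[OF p0 s(1) less_imp_le[OF s(2)]]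
  have geo: "(pgf p ^^ n) s \<le> \<rho> ^ n" for n
  proof (induction n)
    case (Suc n)
    have "(pgf p ^^ Suc n) s \<le> (pgf p ^^ n) s * (pmf p 1 + (1 - pmf p 1) * (pgf p ^^ n) s)"
      using pgf_le_quadratic[OF p0, of "(pgf p ^^ n) s"] bds[of n] s by simp
    also have "\<dots> \<le> \<rho> ^ n * \<rho>"
      unfolding \<rho>_def using bds[of n] s p1 Suc
      by (intro mult_mono add_left_mono mult_left_mono) (auto simp: \<rho>_def)
    finally show ?case by (simp add: mult.commute)
  qed (use s in auto)
  have "(pgf p ^^ n) s \<le> exp (D * (\<Sum>i<n. \<rho> ^ i)) * pmf p 1 ^ n" for n
  proof (induction n)
    case (Suc n)
    have "(pgf p ^^ Suc n) s \<le> (pgf p ^^ n) s * (pmf p 1 + (1 - pmf p 1) * (pgf p ^^ n) s)"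
      using pgf_le_quadratic[OF p0, of "(pgf p ^^ n) s"] bds[of n] s by simp
    also have "\<dots> = pmf p 1 * ((pgf p ^^ n) s * (1 + D * (pgf p ^^ n) s))"
      using p1 by (simp add: D_def field_simps)
    also have "\<dots> \<le> pmf p 1 * ((exp (D * (\<Sum>i<n. \<rho> ^ i)) * pmf p 1 ^ n) * exp (D * \<rho> ^ n))"
    proof (intro mult_left_mono mult_mono)
      have "1 + D * (pgf p ^^ n) s \<le> 1 + D * \<rho> ^ n"
        using geo[of n] D by (auto intro: mult_left_mono)
      also have "\<dots> \<le> exp (D * \<rho> ^ n)" by (rule exp_ge_add_one_self)
      finally show "1 + D * (pgf p ^^ n) s \<le> exp (D * \<rho> ^ n)" .
    qed (use bds[of n] D Suc p1 in auto)
    also have "\<dots> = exp (D * (\<Sum>i<Suc n. \<rho> ^ i)) * pmf p 1 ^ Suc n"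
      by (simp add: algebra_simps exp_add)
    finally show ?case .
  qed (use s in auto)
  moreover have "exp (D * (\<Sum>i<n. \<rho> ^ i)) \<le> exp (D * (1 / (1 - \<rho>)))" for n
  proof -
    have "(\<Sum>i<n. \<rho> ^ i) \<le> (\<Sum>i. \<rho> ^ i)"
      using \<rho> by (intro sum_le_suminf) (auto intro!: summable_geometric)
    also have "\<dots> = 1 / (1 - \<rho>)" using \<rho> by (intro suminf_geometric) auto
    finally show ?thesis
      unfolding exp_le_cancel_iff by (rule mult_left_mono[OF _ D])
  qed
  ultimately have "(pgf p ^^ n) s \<le> exp (D * (1 / (1 - \<rho>))) * pmf p 1 ^ n" for n
    by (rule order_trans[OF _ mult_right_mono]) auto
  then show ?thesis by (intro exI[of _ "exp (D * (1 / (1 - \<rho>)))"]) auto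
qed

section \<open>Behaviour of the generating function near its fixed point 1\<close>

lemma one_minus_power_le:
  fixes u \<gamma> :: real
  assumes u: "0 \<le> u" "u \<le> 1" and \<gamma>: "0 < \<gamma>" "\<gamma> \<le> 1"
  shows "(1 - u) ^ k \<le> 1 - real k * u + (real k * u) powr (1 + \<gamma>)"
proof -
  define x where "x = real k * u"
  have x: "x \<ge> 0" using u by (simp add: x_def)
  show ?thesis
  \<comment> \<open>For x at most 1 this is a second-order estimate, with the square weakened to the
    power 1 + \<gamma> because only that moment will be available. For larger x the right-hand side
    is at least 1.\<close>
  proof (cases "x \<le> 1")
    case True
    have "(1 - u) ^ k \<le> exp (- u) ^ k"
      using u exp_ge_add_one_self[of "- u"] by (intro power_mono) auto
    also have "\<dots> = exp (- x)" by (simp add: exp_of_nat_mult[symmetric] x_def)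
    also have "\<dots> \<le> 1 - x + x\<^sup>2"
    proof -
      \<comment> \<open>After multiplication by \<open>exp x\<close>, which is at least
        \<open>1 + x\<close>, the claim rests on
        \<open>(1 + x) * (1 - x + x\<^sup>2) = 1 + x ^ 3\<close>.\<close>
      have "exp x * (1 - x + x\<^sup>2) \<ge> (1 + x) * (1 - x + x\<^sup>2)"
        using exp_ge_add_one_self[of x] x True by (intro mult_right_mono) auto
      moreover have "(1 + x) * (1 - x + x\<^sup>2) = 1 + x ^ 3"
        by (simp add: algebra_simps power2_eq_square power3_eq_cube)
      ultimately have "exp x * (1 - x + x\<^sup>2) \<ge> 1"
        using x by (smt (verit) zero_le_power)
      then show ?thesis by (simp add: exp_minus field_simps)
    qed
    also have "x\<^sup>2 \<le> x powr (1 + \<gamma>)"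
    proof (cases "x = 0")
      case False
      then have "x\<^sup>2 = x powr 2" using x by (simp add: powr_numeral)
      also have "\<dots> \<le> x powr (1 + \<gamma>)"
        using False x True \<gamma> by (intro powr_mono') auto
      finally show ?thesis .
    qed auto
    finally show ?thesis by (simp add: x_def)
  next
    case False
    have "x powr 1 \<le> x powr (1 + \<gamma>)" using False \<gamma> by (intro powr_mono) auto
    moreover have "(1 - u) ^ k \<le> 1" using u by (intro power_le_one) auto
    ultimately show ?thesis using False by (simp add: x_def)
  qed
qed

lemma one_minus_pgf_ge:
  fixes u \<gamma> :: real
  assumes u: "0 \<le> u" "u \<le> 1" and \<gamma>: "0 < \<gamma>" "\<gamma> \<le> 1"
    and int1: "integrable (measure_pmf p) real"
    and int2: "integrable (measure_pmf p) (\<lambda>k. real k powr (1 + \<gamma>))"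
  shows "1 - pgf p (1 - u) \<ge> offspring_mean p * u
            - measure_pmf.expectation p (\<lambda>k. real k powr (1 + \<gamma>)) * u powr (1 + \<gamma>)"
proof -
  have "pgf p (1 - u) \<le> measure_pmf.expectation p
          (\<lambda>k. 1 - real k * u + real k powr (1 + \<gamma>) * u powr (1 + \<gamma>))"
    unfolding pgf_def using u int1 int2 one_minus_power_le[OF u \<gamma>]
    by (intro integral_mono integrable_pgf) (auto simp: powr_mult)
  also have "\<dots> = 1 - offspring_mean p * u
            + measure_pmf.expectation p (\<lambda>k. real k powr (1 + \<gamma>)) * u powr (1 + \<gamma>)"
    unfolding offspring_mean_def using int1 int2
    by (subst Bochner_Integration.integral_add Bochner_Integration.integral_diff; (simp)?)+
  finally show ?thesis by simp
qed

text \<open>Near u = 0 the quantity \<open>1 - pgf p (1 - u)\<close> is at least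
  \<open>m * u\<close> up to a relative error of order \<open>u powr \<gamma>\<close>. Raising to
  the power -\<gamma> produces the factor \<open>m powr (- \<gamma>) = pmf p 1\<close>, and the
  relative error times \<open>u powr (- \<gamma>)\<close> is a bounded additive term. A moment of
  order exactly 1 + \<gamma> makes these two powers cancel.\<close>

lemma pgf_lyapunov:
  fixes p :: "nat pmf" and \<gamma> :: real
  defines "m \<equiv> offspring_mean p"
  assumes p0: "pmf p 0 = 0" and p1: "0 < pmf p 1" "pmf p 1 < 1"
    and \<gamma>: "0 < \<gamma>" "\<gamma> < 1" and m: "m > 1" and p1m: "pmf p 1 = m powr (- \<gamma>)"
    and int1: "integrable (measure_pmf p) real"
    and int2: "integrable (measure_pmf p) (\<lambda>k. real k powr (1 + \<gamma>))"
  shows "\<exists>C>0. \<forall>u. 0 < u \<and> u \<le> 1 \<longrightarrow>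
           (1 - pgf p (1 - u)) powr (- \<gamma>) \<le> pmf p 1 * (u powr (- \<gamma>) + C)"
proof -
  define K where "K = measure_pmf.expectation p (\<lambda>k. real k powr (1 + \<gamma>))"
  \<comment> \<open>The atom at 1 alone contributes \<open>pmf p 1\<close> to the moment, so K is
    positive.\<close>
  have "pmf p 1 \<le> K"
  proof -
    have "pmf p 1 = measure_pmf.expectation p (indicator {1})"
      by (simp add: measure_pmf_single)
    also have "\<dots> \<le> K" unfolding K_def using int2
      by (intro integral_mono integrable_indicator_pmf) (auto simp: indicator_def)
    finally show ?thesis .
  qed
  then have K: "K > 0" using p1 by simp
  define c where "c = K / m"
  have c: "c > 0" using K m by (simp add: c_def)
  \<comment> \<open>The constant serves both cases below: \<open>2 * c \<le> C\<close> is used for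
    small u, and \<open>pmf p 1 * C = 2 * c\<close> for the remaining u.\<close>
  define C where "C = 2 * c / pmf p 1"
  have C: "C > 0" "2 * c \<le> C" "pmf p 1 * C = 2 * c"
    using c p1 by (auto simp: C_def field_simps)
  have "(1 - pgf p (1 - u)) powr (- \<gamma>) \<le> pmf p 1 * (u powr (- \<gamma>) + C)"
    if u: "0 < u" "u \<le> 1" for u
  proof -
    define w where "w = 1 - pgf p (1 - u)"
    have wu: "w \<ge> u" using pgf_le_self[OF p0, of "1 - u"] u by (simp add: w_def)
    show ?thesis
    \<comment> \<open>A relative error t of at most 1/2 allows the linearisation
      \<open>1 / (1 - t) \<le> 1 + 2 * t\<close>.\<close>
    proof (cases "c * u powr \<gamma> \<le> 1 / 2")
      case True
      define t where "t = c * u powr \<gamma>"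
      have t: "0 \<le> t" "t \<le> 1 / 2" using True c by (auto simp: t_def)
      have "w \<ge> m * u - K * u powr (1 + \<gamma>)"
        using one_minus_pgf_ge[of u \<gamma> p] u \<gamma> int1 int2 by (simp add: w_def m_def K_def)
      also have "m * u - K * u powr (1 + \<gamma>) = m * u * (1 - t)"
        using u m by (simp add: t_def c_def powr_add field_simps)
      finally have "w powr (- \<gamma>) \<le> (m * u * (1 - t)) powr (- \<gamma>)"
        using u m t \<gamma> by (intro powr_mono2') (auto intro!: mult_pos_pos)
      also have "\<dots> = pmf p 1 * u powr (- \<gamma>) * (1 - t) powr (- \<gamma>)"
        using u m t unfolding p1m by (simp add: powr_mult)
      also have "(1 - t) powr (- \<gamma>) \<le> 1 + 2 * t"
      proof -
        have "(1 - t) powr (- \<gamma>) \<le> (1 - t) powr (- 1)"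
          using t \<gamma> by (intro powr_mono') auto
        also have "\<dots> = 1 / (1 - t)" using t by (simp add: powr_minus_divide)
        also have "\<dots> \<le> 1 + 2 * t"
        proof -
          have "t * t \<le> (1 / 2) * t" using t by (intro mult_right_mono) auto
          then have "1 \<le> (1 + 2 * t) * (1 - t)" by (simp add: algebra_simps)
          then show ?thesis using t by (simp add: divide_le_eq)
        qed
        finally show ?thesis .
      qed
      also have "pmf p 1 * u powr (- \<gamma>) * (1 + 2 * t) = pmf p 1 * (u powr (- \<gamma>) + 2 * c)"
        using u by (simp add: t_def powr_minus field_simps)
      also have "\<dots> \<le> pmf p 1 * (u powr (- \<gamma>) + C)"
        using C p1 by (intro mult_left_mono) auto
      finally show ?thesis using p1 by (simp add: w_def mult_left_mono)
    next
      case False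
      \<comment> \<open>Here u is bounded away from 0, so \<open>u powr (- \<gamma>)\<close> is
        below the constant \<open>2 * c\<close>, and \<open>pgf p s \<le> s\<close> is
        enough.\<close>
      have "w powr (- \<gamma>) \<le> u powr (- \<gamma>)" using wu u \<gamma> by (intro powr_mono2') auto
      also have "\<dots> \<le> 2 * c" using False u by (simp add: powr_minus field_simps)
      also have "\<dots> \<le> pmf p 1 * (u powr (- \<gamma>) + C)" using C p1 by (simp add: distrib_left)
      finally show ?thesis by (simp add: w_def)
    qed
  qed
  with C show ?thesis by auto
qed

lemma pgf_iter_growth:
  fixes p :: "nat pmf" and \<gamma> :: real
  defines "m \<equiv> offspring_mean p"
  assumes p0: "pmf p 0 = 0" and p1: "0 < pmf p 1" "pmf p 1 < 1"
    and \<gamma>: "0 < \<gamma>" "\<gamma> < 1" and m: "m > 1" and p1m: "pmf p 1 = m powr (- \<gamma>)"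
    and int1: "integrable (measure_pmf p) real"
    and int2: "integrable (measure_pmf p) (\<lambda>k. real k powr (1 + \<gamma>))"
  shows "\<exists>C>0. \<forall>n. \<forall>x\<ge>1. (pgf p ^^ n) (1 - 1 / (2 * x)) \<le> C * pmf p 1 ^ n * x powr \<gamma>"
proof -
  obtain C where C: "C > 0" and lyap: "\<And>u. 0 < u \<Longrightarrow> u \<le> 1 \<Longrightarrow>
      (1 - pgf p (1 - u)) powr (- \<gamma>) \<le> pmf p 1 * (u powr (- \<gamma>) + C)"
    using pgf_lyapunov[OF p0 p1 \<gamma> m[unfolded m_def] p1m[unfolded m_def] int1 int2] by blast
  \<comment> \<open>D is the fixed point of the map sending d to \<open>pmf p 1 * (d + C)\<close>,
    so the additive errors do not accumulate along the iteration.\<close>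
  define D where "D = pmf p 1 * C / (1 - pmf p 1)"
  have D: "D > 0" "pmf p 1 * D + pmf p 1 * C = D"
    using p1 C by (auto simp: D_def field_simps)
  have iter: "(1 - (pgf p ^^ j) (1 - u)) powr (- \<gamma>) \<le> pmf p 1 ^ j * u powr (- \<gamma>) + D"
    if u: "0 < u" "u \<le> 1" for u j
  proof (induction j)
    case (Suc j)
    define v where "v = 1 - (pgf p ^^ j) (1 - u)"
    have v: "0 < v" "v \<le> 1"
      using pgf_iter_bounds[OF p0, of "1 - u" j] u by (auto simp: v_def)
    have "(1 - (pgf p ^^ Suc j) (1 - u)) powr (- \<gamma>) = (1 - pgf p (1 - v)) powr (- \<gamma>)"
      by (simp add: v_def)
    also have "\<dots> \<le> pmf p 1 * (v powr (- \<gamma>) + C)" by (rule lyap[OF v])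
    also have "\<dots> \<le> pmf p 1 * (pmf p 1 ^ j * u powr (- \<gamma>) + D + C)"
      using Suc p1 by (intro mult_left_mono) (auto simp: v_def)
    also have "\<dots> = pmf p 1 ^ Suc j * u powr (- \<gamma>) + D" using D(2) by (simp add: algebra_simps)
    finally show ?case .
  qed (use D in auto)
  \<comment> \<open>V bounds the Lyapunov function after j steps from
    \<open>1 - 1 / (2 * x)\<close>, once \<open>x powr \<gamma> * pmf p 1 ^ j \<le> 1\<close>; the
    first summand comes from the 2 in that starting point. The point \<open>s0\<close> below is
    where the Lyapunov function equals V.\<close>
  define V where "V = 2 powr \<gamma> + D"
  have V: "V > 1"
    using D \<gamma> ge_one_powr_ge_zero[of 2 \<gamma>] by (simp add: V_def)
  define s0 where "s0 = 1 - V powr (- (1 / \<gamma>))"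
  have s0: "0 \<le> s0" "s0 < 1"
  proof -
    have "V powr (- (1 / \<gamma>)) \<le> V powr 0" using V \<gamma> by (intro powr_mono) auto
    then show "0 \<le> s0" using V by (simp add: s0_def)
    show "s0 < 1" using V by (simp add: s0_def)
  qed
  obtain B where B: "B > 0" "\<And>n. (pgf p ^^ n) s0 \<le> B * pmf p 1 ^ n"
    using pgf_iter_decay[OF p0 p1 s0] by blast
  \<comment> \<open>The summand 1 covers the case of fewer than j iterations; the factor
    \<open>m powr \<gamma>\<close> pays for rounding \<open>log m x\<close> up to an
    integer.\<close>
  define E where "E = (B + 1) * m powr \<gamma>"
  have "(pgf p ^^ n) (1 - 1 / (2 * x)) \<le> E * pmf p 1 ^ n * x powr \<gamma>" if x: "x \<ge> 1" for n x
  proof -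
    define j where "j = nat \<lceil>log m x\<rceil>"
    have lg: "0 \<le> log m x" using x m by simp
    have j1: "log m x \<le> real j" using lg unfolding j_def by linarith
    have j2: "real j \<le> log m x + 1" using lg unfolding j_def by linarith
    have "x = m powr (log m x)" using x m by simp
    have xj: "x powr \<gamma> * pmf p 1 ^ j \<le> 1"
    proof -
      have "x powr \<gamma> = m powr (log m x * \<gamma>)" using x m by (simp add: powr_powr[symmetric])
      also have "\<dots> \<le> m powr (real j * \<gamma>)" using j1 \<gamma> m by (intro powr_mono mult_right_mono) auto
      also have "\<dots> = inverse (pmf p 1 ^ j)"
        using m unfolding p1m
        by (simp add: powr_realpow[symmetric] powr_powr powr_minus[symmetric] mult.commute)
      finally show ?thesis using p1 by (simp add: field_simps)
    qed
    have jx: "1 \<le> m powr \<gamma> * x powr \<gamma> * pmf p 1 ^ j"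
    proof -
      have "inverse (pmf p 1 ^ j) = m powr (real j * \<gamma>)"
        using m unfolding p1m
        by (simp add: powr_realpow[symmetric] powr_powr powr_minus[symmetric] mult.commute)
      also have "\<dots> \<le> m powr ((log m x + 1) * \<gamma>)" using j2 \<gamma> m by (intro powr_mono mult_right_mono) auto
      also have "\<dots> = m powr \<gamma> * x powr \<gamma>"
        using x m by (simp add: distrib_right powr_add powr_powr[symmetric])
      finally show ?thesis using p1 by (simp add: field_simps)
    qed
    define s where "s = 1 - 1 / (2 * x)"
    have s: "0 \<le> s" "s \<le> 1" using x by (auto simp: s_def field_simps)
    have fj: "(pgf p ^^ j) s \<le> s0"
    proof -
      define w where "w = 1 - (pgf p ^^ j) s"
      have "s < 1" using x by (simp add: s_def)
      then have w: "w > 0" using pgf_iter_bounds[OF p0 s, of j] by (simp add: w_def)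
      have "w powr (- \<gamma>) \<le> pmf p 1 ^ j * (1 / (2 * x)) powr (- \<gamma>) + D"
        using iter[of "1 / (2 * x)" j] x by (simp add: w_def s_def)
      also have "(1 / (2 * x)) powr (- \<gamma>) = 2 powr \<gamma> * x powr \<gamma>"
        using x by (simp add: powr_minus powr_divide powr_mult)
      also have "pmf p 1 ^ j * (2 powr \<gamma> * x powr \<gamma>) = 2 powr \<gamma> * (x powr \<gamma> * pmf p 1 ^ j)" by simp
      also have "2 powr \<gamma> * (x powr \<gamma> * pmf p 1 ^ j) + D \<le> V"
        using mult_left_mono[OF xj, of "2 powr \<gamma>"] by (simp add: V_def)
      finally have "V powr (- (1 / \<gamma>)) \<le> (w powr (- \<gamma>)) powr (- (1 / \<gamma>))"
        using w \<gamma> by (intro powr_mono2') auto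
      also have "\<dots> = w" using w \<gamma> by (simp add: powr_powr)
      finally show ?thesis by (simp add: w_def s0_def)
    qed
    have "(pgf p ^^ n) s \<le> E * pmf p 1 ^ n * x powr \<gamma>"
    proof (cases "j \<le> n")
      case True
      \<comment> \<open>The first j iterations bring s below \<open>s0\<close>. Each of the
        remaining \<open>n - j\<close> gains a factor \<open>pmf p 1\<close>, and the j missing
        factors cost at most \<open>m powr \<gamma> * x powr \<gamma>\<close>.\<close>
      then have "(pgf p ^^ n) s = (pgf p ^^ (n - j)) ((pgf p ^^ j) s)"
        by (metis funpow_add le_add_diff_inverse2 o_apply)
      also have "\<dots> \<le> (pgf p ^^ (n - j)) s0"
        using pgf_iter_bounds[OF p0 s, of j] fj s0 by (intro pgf_iter_mono p0) auto
      also have "\<dots> \<le> B * pmf p 1 ^ (n - j)" by (rule B)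
      also have "\<dots> \<le> (B * pmf p 1 ^ (n - j)) * (m powr \<gamma> * x powr \<gamma> * pmf p 1 ^ j)"
        using mult_left_mono[OF jx, of "B * pmf p 1 ^ (n - j)"] B p1 by simp
      also have "\<dots> = B * m powr \<gamma> * pmf p 1 ^ n * x powr \<gamma>"
        using True by (simp add: power_add[symmetric] mult_ac)
      also have "\<dots> \<le> E * pmf p 1 ^ n * x powr \<gamma>"
        using p1 unfolding E_def by (intro mult_right_mono) auto
      finally show ?thesis .
    next
      case False
      \<comment> \<open>With fewer than j iterations \<open>pmf p 1 ^ n\<close> is still at least
        \<open>pmf p 1 ^ j\<close>, and the trivial bound 1 suffices.\<close>
      have "(pgf p ^^ n) s \<le> 1" using pgf_iter_bounds[OF p0 s, of n] s by simp
      also have "\<dots> \<le> m powr \<gamma> * x powr \<gamma> * pmf p 1 ^ j" by (rule jx)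
      also have "\<dots> \<le> m powr \<gamma> * x powr \<gamma> * pmf p 1 ^ n"
        using False p1 by (intro mult_left_mono power_decreasing) auto
      also have "\<dots> = (1 * m powr \<gamma>) * pmf p 1 ^ n * x powr \<gamma>" by simp
      also have "\<dots> \<le> E * pmf p 1 ^ n * x powr \<gamma>"
        using B unfolding E_def by (intro mult_right_mono) auto
      finally show ?thesis .
    qed
    then show ?thesis by (simp add: s_def)
  qed
  moreover have "E > 0" using B m by (auto simp: E_def)
  ultimately show ?thesis by blast
qed

section \<open>Dyadic sums and moments\<close>

text \<open>One term of the sum suffices: the first j with \<open>k \<le> 2 ^ j * x\<close>. For j =
  0 one has \<open>k \<le> x\<close>. For j > 0 the failure at j - 1 bounds
  \<open>(real x)\<^sup>2 / real k\<close> by twice the j-th term. Since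
  \<open>k \<le> 2 ^ k\<close>, this j is at most k and so lies in the range of summation.\<close>

lemma min_le_dyadic_sum:
  fixes k x N :: nat
  assumes x: "x \<ge> 1" and k: "k < N"
  shows "min (real k) ((real x)\<^sup>2 / real k)
    \<le> 2 * (\<Sum>i\<le>N. real x * (1 / 2) ^ i * of_bool (k \<le> 2 ^ i * x))"
proof -
  have "k \<le> 2 ^ k * 1" by (simp add: less_imp_le)
  also have "\<dots> \<le> 2 ^ k * x" using x by (intro mult_left_mono) auto
  finally have ex: "k \<le> 2 ^ k * x" .
  define j where "j = (LEAST i. k \<le> 2 ^ i * x)"
  have j: "k \<le> 2 ^ j * x" unfolding j_def using ex by (rule LeastI)
  have jN: "j \<le> N" using Least_le[of "\<lambda>i. k \<le> 2 ^ i * x", OF ex] k by (simp add: j_def)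
  have "min (real k) ((real x)\<^sup>2 / real k) \<le> 2 * (real x * (1 / 2) ^ j)"
  proof (cases j)
    case 0
    then show ?thesis using j by simp
  next
    case (Suc i)
    then have "\<not> k \<le> 2 ^ i * x" using not_less_Least[of i "\<lambda>i. k \<le> 2 ^ i * x"] by (simp add: j_def)
    then have "real (2 ^ i * x) \<le> real k" by (simp only: of_nat_le_iff)
    then have ki: "2 ^ i * real x \<le> real k" by simp
    have "(real x)\<^sup>2 / real k \<le> (real x)\<^sup>2 / (2 ^ i * real x)"
      using ki x by (intro divide_left_mono) (auto intro!: mult_pos_pos order.strict_trans2[OF _ ki])
    also have "\<dots> = 2 * (real x * (1 / 2) ^ j)"
      using x by (simp add: Suc power2_eq_square field_simps power_divide)
    finally show ?thesis by simp
  qed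
  also have "real x * (1 / 2) ^ j = (\<Sum>i\<in>{j}. real x * (1 / 2) ^ i * of_bool (k \<le> 2 ^ i * x))"
    using j by simp
  also have "2 * \<dots> \<le> 2 * (\<Sum>i\<le>N. real x * (1 / 2) ^ i * of_bool (k \<le> 2 ^ i * x))"
    using jN by (intro mult_left_mono sum_mono2) auto
  finally show ?thesis by simp
qed

text \<open>At scale \<open>2 ^ i * x\<close> the weights add up to at most
  \<open>C * (2 ^ i * x) powr \<gamma>\<close>, while the dyadic bound carries the factor
  \<open>x / 2 ^ i\<close>. The scales thus form a geometric series of ratio
  \<open>2 powr (\<gamma> - 1)\<close>, which converges because \<gamma> < 1.\<close>

lemma sum_mult_min_le:
  fixes a :: "nat \<Rightarrow> real" and C \<gamma> :: real
  assumes a: "\<And>k. a k \<ge> 0" and C: "C \<ge> 0" and \<gamma>: "\<gamma> < 1"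
    and A: "\<And>y. y \<ge> 1 \<Longrightarrow> (\<Sum>k\<le>y. a k) \<le> C * real y powr \<gamma>"
  shows "(\<Sum>k<N. a k * min (real k) ((real x)\<^sup>2 / real k))
           \<le> 2 * C / (1 - 2 powr (\<gamma> - 1)) * real x powr (1 + \<gamma>)"
proof (cases "x = 0")
  case False
  then have x: "x \<ge> 1" by simp
  define r where "r = 2 powr (\<gamma> - 1)"
  have "2 powr (\<gamma> - 1) < 2 powr (0 :: real)" using \<gamma> by (subst powr_less_cancel_iff) auto
  then have r: "0 \<le> r" "r < 1" by (auto simp: r_def)
  have "(\<Sum>k<N. a k * min (real k) ((real x)\<^sup>2 / real k))
      \<le> (\<Sum>k<N. a k * (2 * (\<Sum>i\<le>N. real x * (1 / 2) ^ i * of_bool (k \<le> 2 ^ i * x))))"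
    by (intro sum_mono mult_left_mono min_le_dyadic_sum x a) auto
  also have "\<dots> = (\<Sum>i\<le>N. \<Sum>k<N. 2 * (real x * (1 / 2) ^ i) * (a k * of_bool (k \<le> 2 ^ i * x)))"
    by (subst sum.swap) (simp add: sum_distrib_left mult_ac)
  also have "\<dots> \<le> (\<Sum>i\<le>N. 2 * C * real x powr (1 + \<gamma>) * r ^ i)"
  proof (intro sum_mono)
    fix i
    have "(\<Sum>k<N. a k * of_bool (k \<le> 2 ^ i * x)) = (\<Sum>k\<in>{..<N} \<inter> {..2 ^ i * x}. a k)"
      by (intro sum.mono_neutral_cong_right) auto
    also have "\<dots> \<le> (\<Sum>k\<le>2 ^ i * x. a k)" using a by (intro sum_mono2) auto
    also have "\<dots> \<le> C * real (2 ^ i * x) powr \<gamma>" using x by (intro A) auto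
    finally have "2 * (real x * (1 / 2) ^ i) * (\<Sum>k<N. a k * of_bool (k \<le> 2 ^ i * x))
        \<le> 2 * (real x * (1 / 2) ^ i) * (C * real (2 ^ i * x) powr \<gamma>)"
      by (intro mult_left_mono) auto
    also have "real (2 ^ i * x) powr \<gamma> = (2 ^ i) powr \<gamma> * real x powr \<gamma>"
      by (simp add: powr_mult)
    also have "(2 ^ i) powr \<gamma> = (2 powr \<gamma>) ^ i"
      by (rule power_powr_commute) simp
    also have "2 * (real x * (1 / 2) ^ i) * (C * ((2 powr \<gamma>) ^ i * real x powr \<gamma>))
        = 2 * C * (real x * real x powr \<gamma>) * ((1 / 2) * 2 powr \<gamma>) ^ i"
      by (simp only: power_mult_distrib mult_ac)
    also have "real x * real x powr \<gamma> = real x powr (1 + \<gamma>)"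
      using x by (simp add: powr_add)
    also have "(1 / 2) * 2 powr \<gamma> = r" by (simp add: r_def powr_diff)
    finally show "(\<Sum>k<N. 2 * (real x * (1 / 2) ^ i) * (a k * of_bool (k \<le> 2 ^ i * x)))
        \<le> 2 * C * real x powr (1 + \<gamma>) * r ^ i"
      by (simp only: sum_distrib_left)
  qed
  also have "\<dots> = 2 * C * real x powr (1 + \<gamma>) * (\<Sum>i\<le>N. r ^ i)"
    by (simp add: sum_distrib_left)
  also have "\<dots> \<le> 2 * C * real x powr (1 + \<gamma>) * (1 / (1 - r))"
  proof (rule mult_left_mono)
    have "(\<Sum>i\<le>N. r ^ i) \<le> (\<Sum>i. r ^ i)"
      using r by (intro sum_le_suminf) (auto intro!: summable_geometric)
    also have "\<dots> = 1 / (1 - r)" using r by (intro suminf_geometric) auto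
    finally show "(\<Sum>i\<le>N. r ^ i) \<le> 1 / (1 - r)" .
  qed (use C in auto)
  finally show ?thesis by (simp add: r_def)
qed simp

section \<open>Regularly varying tails and moments\<close>

lemma regularly_varying_doubling:
  fixes F L :: "real \<Rightarrow> real"
  assumes L: "slowly_varying L" and tail: "F \<sim>[at_top] (\<lambda>x. x powr (- \<beta>) * L x)"
  shows "((\<lambda>x. F (2 * x) / F x) \<longlongrightarrow> 2 powr (- \<beta>)) at_top"
    and "\<forall>\<^sub>F x in at_top. F x \<noteq> 0"
proof -
  define g where "g = (\<lambda>x. x powr (- \<beta>) * L x)"
  have Lpos: "L x > 0" if "x > 0" for x
    using L that by (simp add: slowly_varying_def)
  then have g: "g x \<noteq> 0" if "x > 0" for x
    using that by (force simp: g_def)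
  note tail' = tail[folded g_def]
  have ev: "\<forall>\<^sub>F x :: real in at_top. 0 < x" by (rule eventually_gt_at_top)
  show F: "\<forall>\<^sub>F x in at_top. F x \<noteq> 0"
    using asymp_equiv_eventually_zeros[OF tail'] ev by eventually_elim (use g in auto)
  \<comment> \<open>The quotient behind asymptotic equivalence is set to 1 where both functions
    vanish; as g has no positive zero, it is eventually the plain quotient.\<close>
  have Fg: "((\<lambda>x. F x / g x) \<longlongrightarrow> 1) at_top"
    by (rule Lim_transform_eventually[OF asymp_equivD[OF tail']])
       (use ev in \<open>eventually_elim, use g in auto\<close>)
  have lim2: "filterlim (\<lambda>x :: real. 2 * x) at_top at_top"
    by (rule filterlim_tendsto_pos_mult_at_top[OF tendsto_const]) (auto simp: filterlim_ident)
  have L2: "((\<lambda>x. L (2 * x) / L x) \<longlongrightarrow> 1) at_top"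
    using L by (simp add: slowly_varying_def)
  \<comment> \<open>The ratio is factored through g: both comparisons of F with g tend to 1, and
    slow variation leaves only the power of 2.\<close>
  have "((\<lambda>x. (F (2 * x) / g (2 * x)) * (2 powr (- \<beta>) * (L (2 * x) / L x)) / (F x / g x))
          \<longlongrightarrow> 1 * (2 powr (- \<beta>) * 1) / 1) at_top"
    using filterlim_compose[OF Fg lim2] Fg L2 by (intro tendsto_intros) auto
  moreover have "\<forall>\<^sub>F x in at_top.
      (F (2 * x) / g (2 * x)) * (2 powr (- \<beta>) * (L (2 * x) / L x)) / (F x / g x) = F (2 * x) / F x"
    using ev F
  proof eventually_elim
    case (elim x)
    have "g (2 * x) = 2 powr (- \<beta>) * x powr (- \<beta>) * L (2 * x)"
      using elim by (simp add: g_def powr_mult)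
    moreover have "g x = x powr (- \<beta>) * L x" by (simp add: g_def)
    ultimately show ?case
      using elim Lpos[of x] Lpos[of "2 * x"] by (simp add: field_simps)
  qed
  ultimately show "((\<lambda>x. F (2 * x) / F x) \<longlongrightarrow> 2 powr (- \<beta>)) at_top"
    using Lim_transform_eventually by fastforce
qed

lemma summable_ratio_limit:
  fixes c :: "nat \<Rightarrow> real"
  assumes lim: "(\<lambda>n. c (Suc n) / c n) \<longlonglongrightarrow> l" and l: "\<bar>l\<bar> < 1"
    and nz: "\<forall>\<^sub>F n in sequentially. c n \<noteq> 0"
  shows "summable c"
proof -
  obtain r where r: "\<bar>l\<bar> < r" "r < 1" using dense[OF l] by blast
  have "\<forall>\<^sub>F n in sequentially. \<bar>c (Suc n) / c n\<bar> < r"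
    using tendsto_rabs[OF lim] r(1) by (rule order_tendstoD)
  \<comment> \<open>A zero denominator would make the quotient 0 and give no control of
    \<open>c (Suc n)\<close>, hence the assumption \<open>nz\<close>.\<close>
  with nz have "\<forall>\<^sub>F n in sequentially. norm (c (Suc n)) \<le> r * norm (c n)"
    by eventually_elim (auto simp: divide_less_eq abs_divide)
  then obtain N where "\<And>n. n \<ge> N \<Longrightarrow> norm (c (Suc n)) \<le> r * norm (c n)"
    by (auto simp: eventually_sequentially)
  then show ?thesis by (rule summable_ratio_test[OF r(2)])
qed

lemma filterlim_two_power: "filterlim (\<lambda>j. (2::real) ^ j) at_top sequentially"
proof (rule filterlim_at_top_mono[OF filterlim_real_sequentially])
  show "\<forall>\<^sub>F j in sequentially. real j \<le> 2 ^ j"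
    using of_nat_less_two_power[where 'a = real] by (intro always_eventually) (auto intro: less_imp_le)
qed

text \<open>The terms \<open>(2 powr r) ^ j * F (2 ^ j)\<close> are the dyadic contributions to the
  moment of order r. Their limiting ratio is below 1 for r < \<beta> and above 1 for r > \<beta>,
  which decides finiteness of the moment in the two lemmas that follow.\<close>

lemma dyadic_tail_ratio:
  fixes F :: "real \<Rightarrow> real"
  assumes F: "((\<lambda>x. F (2 * x) / F x) \<longlongrightarrow> 2 powr (- \<beta>)) at_top"
    and nz: "\<forall>\<^sub>F x in at_top. F x \<noteq> 0"
  shows "(\<lambda>j. ((2 powr r) ^ Suc j * F (2 ^ Suc j)) / ((2 powr r) ^ j * F (2 ^ j)))
           \<longlonglongrightarrow> 2 powr (r - \<beta>)"
    and "\<forall>\<^sub>F j in sequentially. (2 powr r) ^ j * F (2 ^ j) \<noteq> 0"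
proof -
  have "(\<lambda>j. 2 powr r * (F (2 * 2 ^ j) / F (2 ^ j))) \<longlonglongrightarrow> 2 powr r * 2 powr (- \<beta>)"
    by (intro tendsto_intros filterlim_compose[OF F filterlim_two_power])
  then show "(\<lambda>j. ((2 powr r) ^ Suc j * F (2 ^ Suc j)) / ((2 powr r) ^ j * F (2 ^ j)))
           \<longlonglongrightarrow> 2 powr (r - \<beta>)"
    by (simp add: powr_add[symmetric])
  show "\<forall>\<^sub>F j in sequentially. (2 powr r) ^ j * F (2 ^ j) \<noteq> 0"
    using eventually_compose_filterlim[OF nz filterlim_two_power] by eventually_elim auto
qed

lemma moment_finite_of_tail:
  fixes p :: "nat pmf"
  defines "F \<equiv> \<lambda>x. measure_pmf.prob p {k. x < real k}"
  assumes F: "((\<lambda>x. F (2 * x) / F x) \<longlongrightarrow> 2 powr (- \<beta>)) at_top"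
    and nz: "\<forall>\<^sub>F x in at_top. F x \<noteq> 0" and r: "0 < r" "r < \<beta>"
  shows "integrable (measure_pmf p) (\<lambda>k. real k powr r)"
proof (rule integrableI_nonneg)
  have sm: "summable (\<lambda>j. (2 powr r) ^ j * F (2 ^ j))"
  proof (rule summable_ratio_limit[OF dyadic_tail_ratio(1)[OF F nz] _ dyadic_tail_ratio(2)[OF F nz]])
    have "2 powr (r - \<beta>) < 2 powr (0 :: real)" using r by (subst powr_less_cancel_iff) auto
    then show "\<bar>2 powr (r - \<beta>)\<bar> < 1" by simp
  qed
  \<comment> \<open>The 1 takes care of \<open>k \<le> 1\<close>. A larger k lies between
    \<open>2 ^ i\<close> and \<open>2 ^ Suc i\<close> for some i, and the i-th term of the series
    already dominates \<open>real k powr r\<close>.\<close>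
  have pw: "ennreal (real k powr r)
      \<le> 1 + (\<Sum>j. ennreal (2 powr r * (2 powr r) ^ j) * indicator {k. 2 ^ j < real k} k)" for k
  proof (cases "k \<le> 1")
    case True
    then have "real k powr r \<le> 1" using r by (intro powr_le1) auto
    then have "ennreal (real k powr r) \<le> 1" by simp
    then show ?thesis by (rule order_trans) simp
  next
    case False
    define j where "j = (LEAST i. real k \<le> 2 ^ i)"
    have ex: "real k \<le> 2 ^ k" using of_nat_less_two_power[of k, where 'a = real] by simp
    have j: "real k \<le> 2 ^ j" unfolding j_def using ex by (rule LeastI)
    then obtain i where i: "j = Suc i" using False by (cases j) auto
    then have ki: "2 ^ i < real k"
      using not_less_Least[of i "\<lambda>i. real k \<le> 2 ^ i"] by (simp add: j_def not_le)
    have "real k powr r \<le> (2 ^ j) powr r" using j r by (intro powr_mono2) auto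
    also have "\<dots> = 2 powr r * (2 powr r) ^ i"
      by (simp add: i powr_mult power_powr_commute)
    finally have "ennreal (real k powr r)
        \<le> (\<Sum>j\<in>{i}. ennreal (2 powr r * (2 powr r) ^ j) * indicator {k. 2 ^ j < real k} k)"
      using ki by (simp add: ennreal_leI)
    also have "\<dots> \<le> (\<Sum>j. ennreal (2 powr r * (2 powr r) ^ j) * indicator {k. 2 ^ j < real k} k)"
      by (intro sum_le_suminf) auto
    finally show ?thesis by (simp add: add_increasing)
  qed
  have "(\<integral>\<^sup>+ k. ennreal (real k powr r) \<partial>measure_pmf p)
      \<le> (\<integral>\<^sup>+ k. 1 + (\<Sum>j. ennreal (2 powr r * (2 powr r) ^ j) * indicator {k. 2 ^ j < real k} k) \<partial>measure_pmf p)"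
    by (intro nn_integral_mono pw)
  also have "\<dots> = 1 + (\<Sum>j. ennreal (2 powr r * (2 powr r) ^ j) * emeasure (measure_pmf p) {k. 2 ^ j < real k})"
    by (simp add: nn_integral_add nn_integral_suminf nn_integral_cmult)
  also have "\<dots> = 1 + (\<Sum>j. ennreal (2 powr r * ((2 powr r) ^ j * F (2 ^ j))))"
    by (simp add: measure_pmf.emeasure_eq_measure F_def ennreal_mult mult.assoc)
  also have "\<dots> < \<infinity>"
    using sm by (auto simp: ennreal_suminf_neq_top F_def less_top[symmetric] intro!: ennreal_suminf_neq_top summable_mult)
  finally show "(\<integral>\<^sup>+ k. ennreal (real k powr r) \<partial>measure_pmf p) < \<infinity>" .
qed auto

text \<open>A finite moment would bound the dyadic terms \<open>c j\<close> by Markov's inequality,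
  whereas their ratio tends to a number above 1. Passing to the reciprocals lets the same ratio test
  yield the contradiction: they are summable, hence tend to 0, yet stay above
  \<open>inverse K\<close>.\<close>

lemma moment_infinite_of_tail:
  fixes p :: "nat pmf"
  defines "F \<equiv> \<lambda>x. measure_pmf.prob p {k. x < real k}"
  assumes F: "((\<lambda>x. F (2 * x) / F x) \<longlongrightarrow> 2 powr (- \<beta>)) at_top"
    and nz: "\<forall>\<^sub>F x in at_top. F x \<noteq> 0" and r: "0 < r" "\<beta> < r"
  shows "\<not> integrable (measure_pmf p) (\<lambda>k. real k powr r)"
proof
  assume int: "integrable (measure_pmf p) (\<lambda>k. real k powr r)"
  define K where "K = measure_pmf.expectation p (\<lambda>k. real k powr r)"
  define c where "c = (\<lambda>j. (2 powr r) ^ j * F (2 ^ j))"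
  have c0: "c j \<ge> 0" for j by (simp add: c_def F_def)
  have cK: "c j \<le> K" for j
  proof -
    have "c j = measure_pmf.expectation p (\<lambda>k. (2 powr r) ^ j * indicator {k. 2 ^ j < real k} k)"
      by (simp add: c_def F_def)
    also have "\<dots> \<le> K" unfolding K_def
    proof (intro integral_mono int)
      fix k
      have "(2 powr r) ^ j = (2 ^ j) powr r"
        by (rule power_powr_commute[symmetric]) simp
      then show "(2 powr r) ^ j * indicator {k. 2 ^ j < real k} k \<le> real k powr r"
        using r by (auto simp: indicator_def intro!: powr_mono2)
    qed (intro integrable_mult_right integrable_indicator_pmf)
    finally show ?thesis .
  qed
  note rat = dyadic_tail_ratio[OF F nz, of r]
  have "(\<lambda>j. inverse (c (Suc j) / c j)) \<longlonglongrightarrow> inverse (2 powr (r - \<beta>))"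
    unfolding c_def by (intro tendsto_inverse rat) simp
  then have lim: "(\<lambda>j. inverse (c (Suc j)) / inverse (c j)) \<longlonglongrightarrow> inverse (2 powr (r - \<beta>))"
    by (simp add: field_simps)
  have "summable (\<lambda>j. inverse (c j))"
  proof (rule summable_ratio_limit[OF lim])
    have "2 powr (0 :: real) < 2 powr (r - \<beta>)" using r by (subst powr_less_cancel_iff) auto
    then show "\<bar>inverse (2 powr (r - \<beta>))\<bar> < 1" by (simp add: inverse_eq_divide)
    show "\<forall>\<^sub>F n in sequentially. inverse (c n) \<noteq> 0"
      using rat(2) unfolding c_def by eventually_elim auto
  qed
  then have to0: "(\<lambda>j. inverse (c j)) \<longlonglongrightarrow> 0" by (rule summable_LIMSEQ_zero)
  obtain j0 where "c j0 \<noteq> 0"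
    using eventually_happens[OF rat(2)] by (auto simp: c_def)
  then have K: "K > 0" using c0[of j0] cK[of j0] by linarith
  have "\<forall>\<^sub>F j in sequentially. inverse K \<le> inverse (c j)"
    using rat(2) unfolding c_def[symmetric, THEN fun_cong]
  proof eventually_elim
    case (elim j)
    then have "c j \<noteq> 0" by (simp add: c_def)
    then have "c j > 0" using c0[of j] by linarith
    then show ?case using cK[of j] by (simp add: le_imp_inverse_le)
  qed
  then have "inverse K \<le> 0" by (rule tendsto_lowerbound[OF to0]) simp
  with K show False by simp
qed

section \<open>Deviations of the sample mean\<close>

lemma prob_space_iid_space: "prob_space (iid_space p)"
  unfolding iid_space_def by (intro prob_space_PiM measure_pmf.prob_space_axioms)

lemma space_iid_space [simp]: "space (iid_space p) = UNIV"
  by (simp add: iid_space_def space_PiM)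

lemma sets_iid_space [measurable_cong]:
  "sets (iid_space p) = sets (\<Pi>\<^sub>M i\<in>UNIV. count_space (UNIV :: nat set))"
  unfolding iid_space_def by (intro sets_PiM_cong) auto

lemma distr_iid_space_component:
  "distr (iid_space p) (measure_pmf p) (\<lambda>x. x i) = measure_pmf p"
  unfolding iid_space_def by (rule distr_PiM_component) (auto intro: measure_pmf.prob_space_axioms)

lemma measurable_iid_component [measurable]:
  "(\<lambda>x. x i) \<in> measurable (iid_space p) (count_space UNIV)"
  by measurable

lemma distr_iid_space_component':
  "distr (iid_space p) (count_space UNIV) (\<lambda>x. x i) = measure_pmf p"
proof -
  have "distr (iid_space p) (count_space UNIV) (\<lambda>x. x i) = distr (iid_space p) (measure_pmf p) (\<lambda>x. x i)"
    by (rule distr_cong) auto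
  then show ?thesis by (simp add: distr_iid_space_component)
qed

lemma expectation_iid_component:
  fixes g :: "nat \<Rightarrow> real"
  shows "(\<integral>x. g (x i) \<partial>iid_space p) = measure_pmf.expectation p g"
  by (subst distr_iid_space_component'[of p i, symmetric], subst integral_distr) auto

lemma prob_iid_component:
  "measure (iid_space p) {x. x i \<in> A} = measure_pmf.prob p A"
  by (subst distr_iid_space_component'[of p i, symmetric], subst measure_distr)
     (auto simp: vimage_def)

lemma sets_iid_component [simp]: "{x. x i \<in> A} \<in> sets (iid_space p)"
  using measurable_sets[OF measurable_iid_component[of i p], of A] by (simp add: vimage_def)

lemma indep_vars_iid_space:
  "prob_space.indep_vars (iid_space p) (\<lambda>_. count_space UNIV) (\<lambda>i x. x i) UNIV"
proof -
  interpret prob_space "iid_space p" by (rule prob_space_iid_space)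
  have "distr (iid_space p) (\<Pi>\<^sub>M i\<in>UNIV. count_space UNIV) (\<lambda>x. \<lambda>i\<in>UNIV. x i)
      = distr (iid_space p) (iid_space p) (\<lambda>x. x)"
    by (rule distr_cong) (auto simp: sets_iid_space)
  also have "\<dots> = iid_space p" by (rule distr_id)
  also have "iid_space p = (\<Pi>\<^sub>M i\<in>UNIV. distr (iid_space p) (count_space UNIV) (\<lambda>x. x i))"
    by (simp add: distr_iid_space_component') (simp add: iid_space_def)
  finally show ?thesis by (subst indep_vars_iff_distr_eq_PiM) auto
qed

text \<open>Reconciles two indexings: \<open>\<phi>\<close> sums the coordinates 1 to k, whereas the
  children of a generation are numbered from 0. The product law is invariant under reindexing by the
  injection \<open>Suc\<close>.\<close>

lemma iid_space_shift:
  assumes "A \<in> sets (iid_space p)"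
  shows "measure (iid_space p) {x. (\<lambda>i. x (Suc i)) \<in> A} = measure (iid_space p) A"
proof -
  have "distr (iid_space p) (iid_space p) (\<lambda>x. \<lambda>i\<in>UNIV. x (Suc i)) = iid_space p"
    unfolding iid_space_def
    by (rule distr_PiM_reindex) (auto intro: measure_pmf.prob_space_axioms)
  moreover have "(\<lambda>x i. x (Suc i)) \<in> measurable (iid_space p) (iid_space p)"
    unfolding measurable_cong_sets[OF refl sets_iid_space] by (rule measurable_PiM_single') auto
  ultimately have "measure (iid_space p) A = measure (distr (iid_space p) (iid_space p) (\<lambda>x i. x (Suc i))) A"
    by (simp add: restrict_def)
  also have "\<dots> = measure (iid_space p) {x. (\<lambda>i. x (Suc i)) \<in> A}"
    using assms \<open>_ \<in> measurable _ _\<close> by (subst measure_distr) (auto simp: vimage_def)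
  finally show ?thesis ..
qed

lemma nn_integral_iid_power:
  assumes s: "0 \<le> s" "s \<le> 1"
  shows "(\<integral>\<^sup>+ x. ennreal (s ^ (\<Sum>i<k. x i)) \<partial>iid_space p) = ennreal (pgf p s ^ k)"
proof -
  interpret prob_space "iid_space p" by (rule prob_space_iid_space)
  have ind: "indep_vars (\<lambda>_. borel) (\<lambda>i x. ennreal (s ^ x i)) {..<k}"
    by (rule indep_vars_compose2[OF indep_vars_subset[OF indep_vars_iid_space]]) auto
  have "(\<integral>\<^sup>+ x. ennreal (s ^ (\<Sum>i<k. x i)) \<partial>iid_space p)
      = (\<integral>\<^sup>+ x. (\<Prod>i<k. ennreal (s ^ x i)) \<partial>iid_space p)"
    using s by (simp add: power_sum prod_ennreal)
  also have "\<dots> = (\<Prod>i<k. \<integral>\<^sup>+ x. ennreal (s ^ x i) \<partial>iid_space p)"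
    by (rule indep_vars_nn_integral[OF _ ind]) auto
  also have "\<dots> = (\<Prod>i<k. ennreal (pgf p s))"
  proof (intro prod.cong refl)
    fix i
    have "(\<integral>\<^sup>+ x. ennreal (s ^ x i) \<partial>iid_space p) = (\<integral>\<^sup>+ n. ennreal (s ^ n) \<partial>measure_pmf p)"
      by (subst distr_iid_space_component'[of p i, symmetric], subst nn_integral_distr) auto
    also have "\<dots> = ennreal (pgf p s)"
      unfolding pgf_def using s by (intro nn_integral_eq_integral integrable_pgf) auto
    finally show "(\<integral>\<^sup>+ x. ennreal (s ^ x i) \<partial>iid_space p) = ennreal (pgf p s)" .
  qed
  finally show ?thesis using s by (simp add: ennreal_power pgf_nonneg)
qed

lemma second_moment_iid_sum:
  fixes g :: "nat \<Rightarrow> real"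
  assumes bdd: "\<And>n. \<bar>g n\<bar> \<le> B" and centered: "measure_pmf.expectation p g = 0"
    and I: "finite I"
  shows "integrable (iid_space p) (\<lambda>x. (\<Sum>i\<in>I. g (x i))\<^sup>2)"
    and "(\<integral>x. (\<Sum>i\<in>I. g (x i))\<^sup>2 \<partial>iid_space p)
           = real (card I) * measure_pmf.expectation p (\<lambda>n. (g n)\<^sup>2)"
proof -
  interpret prob_space "iid_space p" by (rule prob_space_iid_space)
  have B: "B \<ge> 0" using bdd[of 0] by linarith
  have int1: "integrable (iid_space p) (\<lambda>x. g (x i))" for i
    by (rule integrable_const_bound[where B = B]) (use bdd in auto)
  have int2: "integrable (iid_space p) (\<lambda>x. g (x i) * g (x j))" for i j
    by (rule integrable_const_bound[where B = "B * B"])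
       (use bdd B in \<open>auto simp: abs_mult intro!: mult_mono\<close>)
  have sq: "(\<Sum>i\<in>I. g (x i))\<^sup>2 = (\<Sum>i\<in>I. \<Sum>j\<in>I. g (x i) * g (x j))" for x
    by (simp add: power2_eq_square sum_product)
  have cross: "(\<integral>x. g (x i) * g (x j) \<partial>iid_space p)
      = (if i = j then measure_pmf.expectation p (\<lambda>n. (g n)\<^sup>2) else 0)" for i j
  proof (cases "i = j")
    case True
    then show ?thesis
      using expectation_iid_component[where g = "\<lambda>n. (g n)\<^sup>2"] by (simp add: power2_eq_square)
  next
    case False
    \<comment> \<open>Two single coordinates are independent as functions of restrictions to
      disjoint index sets; by centering, the mixed products then integrate to 0.\<close>
    have "indep_var borel ((\<lambda>y. g (y i)) \<circ> (\<lambda>x. restrict x {i}))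
        borel ((\<lambda>y. g (y j)) \<circ> (\<lambda>x. restrict x {j}))"
      by (rule indep_var_compose[OF indep_var_restrict[OF indep_vars_iid_space]]) (use False in auto)
    then have "(\<integral>x. g (x i) * g (x j) \<partial>iid_space p)
        = (\<integral>x. g (x i) \<partial>iid_space p) * (\<integral>x. g (x j) \<partial>iid_space p)"
      by (intro indep_var_lebesgue_integral int1) (simp_all add: comp_def)
    then show ?thesis using False by (simp add: expectation_iid_component centered)
  qed
  show "integrable (iid_space p) (\<lambda>x. (\<Sum>i\<in>I. g (x i))\<^sup>2)"
    unfolding sq by (intro Bochner_Integration.integrable_sum int2)
  show "(\<integral>x. (\<Sum>i\<in>I. g (x i))\<^sup>2 \<partial>iid_space p)
           = real (card I) * measure_pmf.expectation p (\<lambda>n. (g n)\<^sup>2)"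
    unfolding sq using I
    by (simp add: Bochner_Integration.integral_sum int2 cross)
qed

section \<open>Truncation and Chebyshev's inequality\<close>

lemma truncated_mean_tendsto:
  assumes int: "integrable (measure_pmf p) real"
  shows "(\<lambda>k. measure_pmf.expectation p (\<lambda>n. real n * indicator {..k} n)) \<longlonglongrightarrow> offspring_mean p"
  unfolding offspring_mean_def
proof (rule integral_dominated_convergence[where w = real])
  show "AE n in measure_pmf p. (\<lambda>k. real n * indicator {..k} n) \<longlonglongrightarrow> real n"
  proof (rule AE_I2)
    fix n :: nat
    have "\<forall>\<^sub>F k in sequentially. real n * indicator {..k} n = real n"
      by (rule eventually_sequentiallyI[of n]) auto
    then show "(\<lambda>k. real n * indicator {..k} n) \<longlonglongrightarrow> real n" by (rule tendsto_eventually)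
  qed
qed (use int in \<open>auto simp: indicator_def\<close>)

lemma integrable_min_square:
  "integrable (measure_pmf p) (\<lambda>n. min (real k) ((real n)\<^sup>2 / real k))"
  by (rule measure_pmf.integrable_const_bound[where B = "real k"]) auto

text \<open>If no summand exceeds k, truncation at level k changes nothing. For large k the
  truncated mean is within \<epsilon> / 2 of m, so a deviation by \<epsilon> forces the centred
  truncated sum to be at least \<open>\<epsilon> / 2 * real k\<close> in absolute value. A union
  bound handles large summands and Chebyshev's inequality the truncated sum.\<close>

lemma \<phi>_le_truncated:
  assumes int: "integrable (measure_pmf p) real" and \<epsilon>: "\<epsilon> > 0"
  shows "\<exists>k0. \<forall>k\<ge>k0. \<phi> p k \<epsilon>
           \<le> (1 + 4 / \<epsilon>\<^sup>2) * measure_pmf.expectation p (\<lambda>n. min (real k) ((real n)\<^sup>2 / real k))"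
proof -
  interpret prob_space "iid_space p" by (rule prob_space_iid_space)
  define m where "m = offspring_mean p"
  \<comment> \<open>Values above k are replaced by 0, not by k.\<close>
  define Y :: "nat \<Rightarrow> nat \<Rightarrow> real" where "Y = (\<lambda>k n. real n * indicator {..k} n)"
  define \<mu> where "\<mu> = (\<lambda>k. measure_pmf.expectation p (Y k))"
  have Yb: "\<bar>Y k n\<bar> \<le> real k" for k n by (auto simp: Y_def indicator_def)
  have intY: "integrable (measure_pmf p) (Y k)" for k
    by (rule measure_pmf.integrable_const_bound[where B = "real k"]) (use Yb in auto)
  have Yb2: "(Y k n)\<^sup>2 \<le> (real k)\<^sup>2" for k n using Yb[of k n] by (metis abs_le_square_iff abs_of_nat)
  have intY2: "integrable (measure_pmf p) (\<lambda>n. (Y k n)\<^sup>2)" for k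
    by (rule measure_pmf.integrable_const_bound[where B = "(real k)\<^sup>2"]) (use Yb2 in auto)
  have "\<mu> \<longlonglongrightarrow> m"
    using truncated_mean_tendsto[OF int] by (simp add: \<mu>_def Y_def m_def)
  then have "\<forall>\<^sub>F k in sequentially. dist (\<mu> k) m < \<epsilon> / 2" using \<epsilon> by (intro tendstoD) auto
  then obtain k0 where k0: "\<And>k. k \<ge> k0 \<Longrightarrow> \<bar>\<mu> k - m\<bar> < \<epsilon> / 2"
    by (auto simp: eventually_sequentially dist_real_def)
  have "\<phi> p k \<epsilon> \<le> (1 + 4 / \<epsilon>\<^sup>2) * measure_pmf.expectation p (\<lambda>n. min (real k) ((real n)\<^sup>2 / real k))"
    if k: "k \<ge> max 1 k0" for k
  proof -
    have k1: "k \<ge> 1" and mk: "\<bar>\<mu> k - m\<bar> < \<epsilon> / 2" using k k0[of k] by auto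
    define g where "g = (\<lambda>n. Y k n - \<mu> k)"
    have gB: "\<bar>g n\<bar> \<le> real k + \<bar>\<mu> k\<bar>" for n using Yb[of k n] by (simp add: g_def)
    have g0: "measure_pmf.expectation p g = 0"
      using intY[of k] by (simp add: g_def \<mu>_def)
    have g2: "measure_pmf.expectation p (\<lambda>n. (g n)\<^sup>2) \<le> measure_pmf.expectation p (\<lambda>n. (Y k n)\<^sup>2)"
      using measure_pmf.variance_eq[OF intY[of k] intY2[of k]] by (simp add: g_def \<mu>_def)
    define D where "D = {x. (\<Sum>i=1..k. g (x i))\<^sup>2 \<ge> (\<epsilon> / 2 * real k)\<^sup>2}"
    have "{x \<in> space (iid_space p). (\<epsilon> / 2 * real k)\<^sup>2 \<le> (\<Sum>i=1..k. g (x i))\<^sup>2} \<in> sets (iid_space p)"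
      by measurable
    then have Dset: "D \<in> sets (iid_space p)" by (simp add: D_def)
    have sub: "{x. \<bar>1 / real k * (\<Sum>i=1..k. real (x i)) - m\<bar> \<ge> \<epsilon>}
        \<subseteq> (\<Union>i\<in>{1..k}. {x. x i \<in> {k<..}}) \<union> D"
    proof (rule subsetI, rule ccontr)
      fix x
      assume x: "x \<in> {x. \<bar>1 / real k * (\<Sum>i=1..k. real (x i)) - m\<bar> \<ge> \<epsilon>}"
        and nx: "x \<notin> (\<Union>i\<in>{1..k}. {x. x i \<in> {k<..}}) \<union> D"
      have "(\<Sum>i=1..k. g (x i)) = (\<Sum>i=1..k. real (x i) - \<mu> k)"
        using nx by (intro sum.cong) (force simp: g_def Y_def indicator_def not_less)+
      also have "\<dots> = real k * (1 / real k * (\<Sum>i=1..k. real (x i)) - \<mu> k)"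
        using k1 by (simp add: sum_subtractf algebra_simps)
      finally have "\<bar>\<Sum>i=1..k. g (x i)\<bar> = real k * \<bar>1 / real k * (\<Sum>i=1..k. real (x i)) - \<mu> k\<bar>"
        by (simp add: abs_mult)
      moreover have "\<bar>1 / real k * (\<Sum>i=1..k. real (x i)) - \<mu> k\<bar> \<ge> \<epsilon> / 2"
        using x mk unfolding mem_Collect_eq by linarith
      ultimately have "\<bar>\<Sum>i=1..k. g (x i)\<bar> \<ge> \<epsilon> / 2 * real k"
        by (metis mult.commute mult_left_mono of_nat_0_le_iff)
      then have "(\<epsilon> / 2 * real k)\<^sup>2 \<le> (\<Sum>i=1..k. g (x i))\<^sup>2"
        using \<epsilon> by (subst abs_le_square_iff[symmetric]) auto
      with nx show False by (auto simp: D_def)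
    qed
    have "\<phi> p k \<epsilon> = prob {x. \<bar>1 / real k * (\<Sum>i=1..k. real (x i)) - m\<bar> \<ge> \<epsilon>}"
      by (simp add: \<phi>_def m_def)
    also have "\<dots> \<le> prob ((\<Union>i\<in>{1..k}. {x. x i \<in> {k<..}}) \<union> D)"
      using Dset by (intro finite_measure_mono sub sets.Un sets.finite_UN sets_iid_component) auto
    also have "\<dots> \<le> prob (\<Union>i\<in>{1..k}. {x. x i \<in> {k<..}}) + prob D"
      using Dset by (intro measure_Un_le sets.finite_UN sets_iid_component) auto
    also have "prob (\<Union>i\<in>{1..k}. {x. x i \<in> {k<..}}) \<le> (\<Sum>i\<in>{1..k}. prob {x. x i \<in> {k<..}})"
      by (intro measure_UNION_le sets_iid_component) auto
    also have "\<dots> = real k * measure_pmf.prob p {k<..}"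
      by (simp only: prob_iid_component) simp
    also have "prob D \<le> (\<integral>x. (\<Sum>i=1..k. g (x i))\<^sup>2 \<partial>iid_space p) / (\<epsilon> / 2 * real k)\<^sup>2"
    proof -
      have "prob {x \<in> space (iid_space p). (\<epsilon> / 2 * real k)\<^sup>2 \<le> (\<Sum>i=1..k. g (x i))\<^sup>2}
          \<le> (\<integral>x. (\<Sum>i=1..k. g (x i))\<^sup>2 \<partial>iid_space p) / (\<epsilon> / 2 * real k)\<^sup>2"
        using \<epsilon> k1 second_moment_iid_sum(1)[OF gB g0, of "{1..k}"]
        by (intro integral_Markov_inequality_measure[where A = "{}"]) auto
      then show ?thesis by (simp add: D_def)
    qed
    also have "\<dots> = real k * measure_pmf.expectation p (\<lambda>n. (g n)\<^sup>2) / (\<epsilon> / 2 * real k)\<^sup>2"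
      by (subst second_moment_iid_sum(2)[OF gB g0]) auto
    also have "\<dots> \<le> real k * measure_pmf.expectation p (\<lambda>n. (Y k n)\<^sup>2) / (\<epsilon> / 2 * real k)\<^sup>2"
      using g2 by (intro divide_right_mono mult_left_mono) auto
    also have "\<dots> = 4 / \<epsilon>\<^sup>2 * measure_pmf.expectation p (\<lambda>n. (Y k n)\<^sup>2 / real k)"
      using k1 \<epsilon> by (simp add: power2_eq_square field_simps)
    also have "real k * measure_pmf.prob p {k<..}
        = measure_pmf.expectation p (\<lambda>n. real k * indicator {k<..} n)"
      by simp
    \<comment> \<open>The first expectation lives on n > k, where the minimum is k; the second on
      \<open>n \<le> k\<close>, where it is \<open>(real n)\<^sup>2 / real k\<close>. Each is
      therefore at most the expectation of the minimum.\<close>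
    also have "\<dots> + 4 / \<epsilon>\<^sup>2 * measure_pmf.expectation p (\<lambda>n. (Y k n)\<^sup>2 / real k)
        \<le> (1 + 4 / \<epsilon>\<^sup>2) * measure_pmf.expectation p (\<lambda>n. min (real k) ((real n)\<^sup>2 / real k))"
    proof -
      have "measure_pmf.expectation p (\<lambda>n. real k * indicator {k<..} n)
          \<le> measure_pmf.expectation p (\<lambda>n. min (real k) ((real n)\<^sup>2 / real k))"
      proof (intro integral_mono integrable_min_square integrable_mult_right integrable_indicator_pmf)
        fix n
        show "real k * indicator {k<..} n \<le> min (real k) ((real n)\<^sup>2 / real k)"
        proof (cases "k < n")
          case True
          then have "real k * real k \<le> real n * real n" by (intro mult_mono) auto
          then show ?thesis using True k1 by (simp add: power2_eq_square pos_le_divide_eq)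
        qed auto
      qed
      moreover have "measure_pmf.expectation p (\<lambda>n. (Y k n)\<^sup>2 / real k)
          \<le> measure_pmf.expectation p (\<lambda>n. min (real k) ((real n)\<^sup>2 / real k))"
      proof (intro integral_mono integrable_min_square)
        fix n
        show "(Y k n)\<^sup>2 / real k \<le> min (real k) ((real n)\<^sup>2 / real k)"
        proof (cases "n \<le> k")
          case True
          then have "real n * real n \<le> real k * real k" by (intro mult_mono) auto
          then show ?thesis using True k1 by (simp add: Y_def power2_eq_square pos_divide_le_eq)
        qed (auto simp: Y_def)
      qed (use intY2[of k] in simp)
      ultimately show ?thesis
        unfolding distrib_right mult_1_left by (intro add_mono mult_left_mono) auto
    qed
    finally show ?thesis by simp
  qed
  then show ?thesis by blast
qed

section \<open>The branching process as a Markov chain\<close>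

text \<open>Expresses the generation size as a deterministic function of the whole offspring array,
  so that its dependence on rows below n alone can be stated and turned into independence from row
  n.\<close>

primrec gw_size :: "nat \<Rightarrow> (nat \<times> nat \<Rightarrow> nat) \<Rightarrow> nat" where
  "gw_size 0 x = 1"
| "gw_size (Suc n) x = (\<Sum>i<gw_size n x. x (n, i))"

lemma gw_size_cong:
  "(\<And>l i. l < n \<Longrightarrow> x (l, i) = y (l, i)) \<Longrightarrow> gw_size n x = gw_size n y"
  by (induction n) auto

lemma measurable_gw_size:
  "n \<le> N \<Longrightarrow> gw_size n \<in> measurable (\<Pi>\<^sub>M _\<in>{..<N} \<times> UNIV. count_space UNIV) (count_space UNIV)"
proof (induction n)
  case 0
  have "gw_size 0 = (\<lambda>_. 1)" by (rule ext) simp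
  then show ?case by simp
next
  case (Suc n)
  let ?M = "\<Pi>\<^sub>M _\<in>{..<N} \<times> (UNIV :: nat set). count_space (UNIV :: nat set)"
  have [measurable]: "(\<lambda>x. x (n, i)) \<in> measurable ?M (count_space UNIV)" for i
    by (rule measurable_component_singleton) (use Suc.prems in auto)
  have "(\<lambda>x. \<Sum>i<gw_size n x. x (n, i)) \<in> measurable ?M (count_space UNIV)"
    \<comment> \<open>The number of summands is itself random; it takes countably many values, and
      for each of them the sum is measurable.\<close>
    by (rule measurable_compose_countable[where f = "\<lambda>k x. \<Sum>i<k. x (n, i)"])
       (use Suc in auto)
  moreover have "gw_size (Suc n) = (\<lambda>x. \<Sum>i<gw_size n x. x (n, i))" by (rule ext) simp
  ultimately show ?case by simp
qed

context galton_watson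
begin

lemma measurable_offspring [measurable]: "\<xi> n i \<in> measurable M (count_space UNIV)"
  using indep_offspring unfolding indep_vars_def by auto

lemma Z_eq_gw_size: "\<omega> \<in> space M \<Longrightarrow> Z n \<omega> = gw_size n (\<lambda>(l, i). \<xi> l i \<omega>)"
  by (induction n) (simp_all add: Z_0 Z_Suc)

lemma Z_eq_gw_size_restrict:
  "\<omega> \<in> space M \<Longrightarrow> Z n \<omega> = gw_size n (restrict (\<lambda>y. case y of (l, i) \<Rightarrow> \<xi> l i \<omega>) ({..<n} \<times> UNIV))"
  unfolding Z_eq_gw_size by (rule gw_size_cong) simp

lemma measurable_Z [measurable]: "Z n \<in> measurable M (count_space UNIV)"
proof -
  have "(\<lambda>\<omega>. gw_size n (restrict (\<lambda>y. case y of (l, i) \<Rightarrow> \<xi> l i \<omega>) ({..<n} \<times> UNIV)))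
      \<in> measurable M (count_space UNIV)"
    by (rule measurable_compose[OF measurable_restrict measurable_gw_size]) auto
  then show ?thesis by (subst measurable_cong[OF Z_eq_gw_size_restrict])
qed

lemma measurable_offspring_row: "(\<lambda>\<omega> i. \<xi> n i \<omega>) \<in> measurable M (iid_space p)"
  unfolding measurable_cong_sets[OF refl sets_iid_space] by (rule measurable_PiM_single') auto

text \<open>By independence the entire array has a product law, and row n is its image under the
  reindexing of coordinates by the injection sending i to (n, i).\<close>

lemma distr_offspring_row: "distr M (iid_space p) (\<lambda>\<omega> i. \<xi> n i \<omega>) = iid_space p"
proof -
  let ?\<xi> = "\<lambda>\<omega> (l, i). \<xi> l i \<omega>"
  let ?P = "\<Pi>\<^sub>M _\<in>(UNIV :: (nat \<times> nat) set). measure_pmf p"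
  have sets: "sets ?P = sets (\<Pi>\<^sub>M _\<in>(UNIV :: (nat \<times> nat) set). count_space UNIV)"
    by (intro sets_PiM_cong) auto
  have meas: "?\<xi> \<in> measurable M ?P"
    unfolding measurable_cong_sets[OF refl sets] by (rule measurable_PiM_single') auto
  have "(\<lambda>x i. x (n, i)) \<in> measurable ?P (\<Pi>\<^sub>M i\<in>UNIV. measure_pmf p)"
  proof (rule measurable_PiM_single')
    show "(\<lambda>x. x (n, i)) \<in> measurable ?P (measure_pmf p)" for i
      by (rule measurable_component_singleton) simp
  qed simp
  then have proj: "(\<lambda>x i. x (n, i)) \<in> measurable ?P (iid_space p)" by (simp add: iid_space_def)
  have "distr M ?P ?\<xi> = distr M (\<Pi>\<^sub>M _\<in>UNIV. count_space UNIV) (\<lambda>\<omega>. \<lambda>y\<in>UNIV. (case y of (l, i) \<Rightarrow> \<xi> l i) \<omega>)"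
    by (rule distr_cong) (auto simp: sets fun_eq_iff)
  also have "\<dots> = (\<Pi>\<^sub>M y\<in>UNIV. distr M (count_space UNIV) (case y of (l, i) \<Rightarrow> \<xi> l i))"
    by (rule indep_vars_iff_distr_eq_PiM[THEN iffD1]) (use indep_offspring in auto)
  also have "\<dots> = ?P" by (rule PiM_cong) (auto simp: distr_offspring)
  finally have full: "distr M ?P ?\<xi> = ?P" .
  have "distr M (iid_space p) (\<lambda>\<omega> i. \<xi> n i \<omega>) = distr (distr M ?P ?\<xi>) (iid_space p) (\<lambda>x i. x (n, i))"
    by (subst distr_distr[OF proj meas]) (simp add: comp_def)
  also have "\<dots> = distr ?P (\<Pi>\<^sub>M i\<in>UNIV. measure_pmf p) (\<lambda>x. \<lambda>i\<in>UNIV. x (n, i))"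
    by (simp add: full iid_space_def restrict_def)
  also have "\<dots> = iid_space p"
    unfolding iid_space_def
    by (rule distr_PiM_reindex) (auto intro: measure_pmf.prob_space_axioms simp: inj_on_def)
  finally show ?thesis .
qed

text \<open>
  \<^const>\<open>prob_space.indep_var\<close> requires both variables to have the same type, so \<open>Z n\<close> is encoded as a
  constant row.
\<close>

lemma indep_Z_offspring_row:
  "indep_var (iid_space p) (\<lambda>\<omega> _. Z n \<omega>) (iid_space p) (\<lambda>\<omega> i. \<xi> n i \<omega>)"
proof -
  \<comment> \<open>Generation n reads only the rows below n, so it and row n use disjoint parts of
    the array.\<close>
  let ?A = "{..<n} \<times> (UNIV :: nat set)" and ?B = "{n} \<times> (UNIV :: nat set)"
  let ?\<xi> = "\<lambda>(l, i). \<xi> l i"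
  have "(\<lambda>x i. x (n, i)) \<in> measurable (\<Pi>\<^sub>M _\<in>?B. count_space UNIV) (\<Pi>\<^sub>M _\<in>UNIV. count_space (UNIV :: nat set))"
    by (rule measurable_PiM_single') (auto intro: measurable_component_singleton)
  then have "(\<lambda>x i. x (n, i)) \<in> measurable (\<Pi>\<^sub>M _\<in>?B. count_space UNIV) (iid_space p)"
    unfolding measurable_cong_sets[OF refl sets_iid_space] .
  moreover have "(\<lambda>x _. gw_size n x) \<in> measurable (\<Pi>\<^sub>M _\<in>?A. count_space UNIV) (iid_space p)"
    unfolding measurable_cong_sets[OF refl sets_iid_space]
    by (rule measurable_PiM_single') (auto intro: measurable_gw_size)
  ultimately have "indep_var
      (iid_space p) ((\<lambda>x _. gw_size n x) \<circ> (\<lambda>\<omega>. restrict (\<lambda>i. ?\<xi> i \<omega>) ?A))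
      (iid_space p) ((\<lambda>x i. x (n, i)) \<circ> (\<lambda>\<omega>. restrict (\<lambda>i. ?\<xi> i \<omega>) ?B))"
    by (intro indep_var_compose[OF indep_var_restrict[OF indep_offspring]]) auto
  moreover have "gw_size n (restrict (\<lambda>i. ?\<xi> i \<omega>) ?A) = Z n \<omega>" if "\<omega> \<in> space M" for \<omega>
    using that by (auto simp: Z_eq_gw_size intro!: gw_size_cong)
  ultimately show ?thesis
    unfolding indep_var_distribution_eq
    by (auto simp: comp_def measurable_offspring_row cong: distr_cong measurable_cong)
qed

lemma prob_Z_offspring_row:
  assumes "B \<in> sets (iid_space p)"
  shows "prob {\<omega>\<in>space M. Z n \<omega> = k \<and> (\<lambda>i. \<xi> n i \<omega>) \<in> B}
           = prob {\<omega>\<in>space M. Z n \<omega> = k} * measure (iid_space p) B"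
proof -
  have "prob {\<omega>\<in>space M. Z n \<omega> = k \<and> (\<lambda>i. \<xi> n i \<omega>) \<in> B}
      = prob ((\<lambda>\<omega>. (\<lambda>_. Z n \<omega>, \<lambda>i. \<xi> n i \<omega>)) -` ({x :: nat \<Rightarrow> nat. x 0 \<in> {k}} \<times> B) \<inter> space M)"
    by (rule arg_cong[where f = prob]) auto
  also have "\<dots> = prob ((\<lambda>\<omega> _. Z n \<omega>) -` {x :: nat \<Rightarrow> nat. x 0 \<in> {k}} \<inter> space M)
      * prob ((\<lambda>\<omega> i. \<xi> n i \<omega>) -` B \<inter> space M)"
    by (rule indep_varD[OF indep_Z_offspring_row sets_iid_component assms])
  also have "(\<lambda>\<omega> _. Z n \<omega>) -` {x :: nat \<Rightarrow> nat. x 0 \<in> {k}} \<inter> space M = {\<omega>\<in>space M. Z n \<omega> = k}" by auto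
  also have "prob ((\<lambda>\<omega> i. \<xi> n i \<omega>) -` B \<inter> space M) = measure (iid_space p) B"
    using measure_distr[OF measurable_offspring_row assms] by (simp add: distr_offspring_row)
  finally show ?thesis .
qed

text \<open>Total probability over the values of \<open>Z n\<close>, with an event that may depend
  on that value. It yields both the transition probabilities of the chain and the law of the
  ratio.\<close>

lemma sums_prob_Z_offspring_row:
  assumes B: "\<And>k. B k \<in> sets (iid_space p)"
  shows "(\<lambda>k. prob {\<omega>\<in>space M. Z n \<omega> = k} * measure (iid_space p) (B k))
           sums prob {\<omega>\<in>space M. (\<lambda>i. \<xi> n i \<omega>) \<in> B (Z n \<omega>)}"
proof -
  let ?A = "\<lambda>k. {\<omega>\<in>space M. Z n \<omega> = k \<and> (\<lambda>i. \<xi> n i \<omega>) \<in> B k}"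
  have "?A k \<in> events" for k
    using measurable_sets[OF measurable_offspring_row B[of k]]
          measurable_sets[OF measurable_Z, of "{k}" n]
    by (auto simp: vimage_def Int_def conj_ac dest: sets.Int)
  then have "(\<lambda>k. prob (?A k)) sums prob (\<Union>k. ?A k)"
    by (intro finite_measure_UNION) (auto simp: disjoint_family_on_def)
  moreover have "(\<Union>k. ?A k) = {\<omega>\<in>space M. (\<lambda>i. \<xi> n i \<omega>) \<in> B (Z n \<omega>)}" by auto
  ultimately show ?thesis by (simp add: prob_Z_offspring_row B)
qed

text \<open>Integrating out row n first replaces \<open>s\<close> by \<open>pgf p s\<close> and
  \<open>Z (Suc n)\<close> by \<open>Z n\<close>. The argument changes, so the induction is over all
  s.\<close>

lemma nn_integral_Z_power:
  assumes p0: "pmf p 0 = 0" and s: "0 \<le> s" "s \<le> 1"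
  shows "(\<integral>\<^sup>+ \<omega>. ennreal (s ^ Z n \<omega>) \<partial>M) = ennreal ((pgf p ^^ n) s)"
  using s
proof (induction n arbitrary: s)
  case 0
  have "(\<integral>\<^sup>+ \<omega>. ennreal (s ^ Z 0 \<omega>) \<partial>M) = (\<integral>\<^sup>+ \<omega>. ennreal s \<partial>M)"
    by (intro nn_integral_cong) (simp add: Z_0)
  then show ?case by (simp add: emeasure_space_1)
next
  case (Suc n)
  interpret iid: prob_space "iid_space p" by (rule prob_space_iid_space)
  \<comment> \<open>The generation size is recovered from its constant row by reading coordinate
    0.\<close>
  let ?F = "\<lambda>(z :: nat \<Rightarrow> nat, x :: nat \<Rightarrow> nat). ennreal (s ^ (\<Sum>i<z 0. x i))"
  have meas [measurable]: "?F \<in> borel_measurable (iid_space p \<Otimes>\<^sub>M iid_space p)"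
  proof -
    have "(\<lambda>y. ennreal (s ^ (\<Sum>i<fst y 0. snd y i))) \<in> borel_measurable (iid_space p \<Otimes>\<^sub>M iid_space p)"
      by (rule measurable_compose_countable[where f = "\<lambda>k y. ennreal (s ^ (\<Sum>i<k. snd y i))"])
         measurable
    then show ?thesis by (simp add: case_prod_beta')
  qed
  have ind: "(\<lambda>\<omega> _. Z n \<omega>) \<in> measurable M (iid_space p)"
    and eq: "distr M (iid_space p) (\<lambda>\<omega> _. Z n \<omega>) \<Otimes>\<^sub>M iid_space p
      = distr M (iid_space p \<Otimes>\<^sub>M iid_space p) (\<lambda>\<omega>. (\<lambda>_. Z n \<omega>, \<lambda>i. \<xi> n i \<omega>))"
    using indep_Z_offspring_row[of n] by (simp_all add: indep_var_distribution_eq distr_offspring_row)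
  have "(\<integral>\<^sup>+ \<omega>. ennreal (s ^ Z (Suc n) \<omega>) \<partial>M) = (\<integral>\<^sup>+ \<omega>. ?F (\<lambda>_. Z n \<omega>, \<lambda>i. \<xi> n i \<omega>) \<partial>M)"
    by (intro nn_integral_cong) (simp add: Z_Suc)
  also have "\<dots> = (\<integral>\<^sup>+ y. ?F y \<partial>distr M (iid_space p \<Otimes>\<^sub>M iid_space p) (\<lambda>\<omega>. (\<lambda>_. Z n \<omega>, \<lambda>i. \<xi> n i \<omega>)))"
    by (rule nn_integral_distr[symmetric]) (use meas ind measurable_offspring_row in auto)
  also have "\<dots> = (\<integral>\<^sup>+ z. \<integral>\<^sup>+ x. ?F (z, x) \<partial>iid_space p \<partial>distr M (iid_space p) (\<lambda>\<omega> _. Z n \<omega>))"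
    unfolding eq[symmetric] by (rule iid.nn_integral_fst[symmetric]) (use meas in simp)
  also have "\<dots> = (\<integral>\<^sup>+ z. ennreal (pgf p s ^ z 0) \<partial>distr M (iid_space p) (\<lambda>\<omega> _. Z n \<omega>))"
    using Suc.prems by (simp add: nn_integral_iid_power)
  also have "\<dots> = (\<integral>\<^sup>+ \<omega>. ennreal (pgf p s ^ Z n \<omega>) \<partial>M)"
    by (rule nn_integral_distr[OF ind]) measurable
  also have "\<dots> = ennreal ((pgf p ^^ n) (pgf p s))"
    using Suc.prems pgf_nonneg[of s p] pgf_le_self[OF p0, of s] by (intro Suc.IH) auto
  finally show ?case by (simp add: funpow_swap1)
qed

text \<open>A Markov bound for \<open>s ^ Z n\<close>: with \<open>s = 1 - 1 / (2 * x)\<close>,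
  Bernoulli's inequality gives \<open>1 / 2 \<le> s ^ k\<close> for all
  \<open>k \<le> x\<close>.\<close>

lemma prob_Z_le:
  assumes p0: "pmf p 0 = 0" and x: "x \<ge> 1"
  shows "prob {\<omega>\<in>space M. Z n \<omega> \<le> x} \<le> 2 * (pgf p ^^ n) (1 - 1 / (2 * real x))"
proof -
  define s where "s = 1 - 1 / (2 * real x)"
  have s: "0 \<le> s" "s \<le> 1" using x by (auto simp: s_def field_simps)
  have "1 / 2 \<le> s ^ x"
  proof -
    have "1 + real x * (- 1 / (2 * real x)) \<le> (1 + (- 1 / (2 * real x))) ^ x"
      using x by (intro Bernoulli_inequality) (auto simp: field_simps)
    then show ?thesis using x by (simp add: s_def)
  qed
  then have half: "1 / 2 \<le> s ^ k" if "k \<le> x" for k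
    using power_decreasing[OF that s] by linarith
  have pw: "ennreal (1 / 2) * indicator {\<omega>\<in>space M. Z n \<omega> \<le> x} \<omega> \<le> ennreal (s ^ Z n \<omega>)" for \<omega>
    using ennreal_leI[OF half[of "Z n \<omega>"]] by (cases "Z n \<omega> \<le> x") (simp_all add: indicator_def)
  have "ennreal (1 / 2) * emeasure M {\<omega>\<in>space M. Z n \<omega> \<le> x}
      = (\<integral>\<^sup>+ \<omega>. ennreal (1 / 2) * indicator {\<omega>\<in>space M. Z n \<omega> \<le> x} \<omega> \<partial>M)"
    by (rule nn_integral_cmult_indicator[symmetric]) measurable
  also have "\<dots> \<le> (\<integral>\<^sup>+ \<omega>. ennreal (s ^ Z n \<omega>) \<partial>M)" by (intro nn_integral_mono pw)
  also have "\<dots> = ennreal ((pgf p ^^ n) s)" by (rule nn_integral_Z_power[OF p0 s])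
  finally have "ennreal (1 / 2 * prob {\<omega>\<in>space M. Z n \<omega> \<le> x}) \<le> ennreal ((pgf p ^^ n) s)"
    unfolding emeasure_eq_measure by (subst ennreal_mult) auto
  then have "1 / 2 * prob {\<omega>\<in>space M. Z n \<omega> \<le> x} \<le> (pgf p ^^ n) s"
    using pgf_iter_bounds(1)[OF p0 s] by (simp add: ennreal_le_iff)
  then show ?thesis by (simp add: s_def)
qed

section \<open>First generation, transition probabilities and the ratio event\<close>

lemma prob_Z_1: "prob {\<omega>\<in>space M. Z 1 \<omega> \<in> A} = measure_pmf.prob p A"
proof -
  have "prob {\<omega>\<in>space M. Z 1 \<omega> \<in> A} = prob (\<xi> 0 0 -` A \<inter> space M)"
    by (rule arg_cong[where f = prob]) (auto simp: Z_0 Z_Suc)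
  also have "\<dots> = measure_pmf.prob p A"
    using measure_distr[OF measurable_offspring, of A 0 0] by (simp add: distr_offspring)
  finally show ?thesis .
qed

lemma integrable_Z_1_iff:
  fixes g :: "nat \<Rightarrow> real"
  shows "integrable M (\<lambda>\<omega>. g (Z 1 \<omega>)) \<longleftrightarrow> integrable (measure_pmf p) g"
proof -
  have "integrable M (\<lambda>\<omega>. g (Z 1 \<omega>)) \<longleftrightarrow> integrable M (\<lambda>\<omega>. g (\<xi> 0 0 \<omega>))"
    by (intro Bochner_Integration.integrable_cong) (auto simp: Z_0 Z_Suc)
  also have "\<dots> \<longleftrightarrow> integrable (distr M (count_space UNIV) (\<xi> 0 0)) g"
    by (rule integrable_distr_eq[symmetric]) auto
  finally show ?thesis by (simp add: distr_offspring)
qed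

lemma iid_sum_event:
  "{x. P (\<Sum>i<k. x i :: nat)} \<in> sets (iid_space p)"
proof -
  have "(\<lambda>x. \<Sum>i<k. x i) \<in> measurable (iid_space p) (count_space UNIV)" by measurable
  from measurable_sets[OF this, of "{n. P n}"] show ?thesis by (simp add: vimage_def)
qed

lemma prob_Z_Suc_sums:
  "(\<lambda>j. prob {\<omega>\<in>space M. Z n \<omega> = j} * measure (iid_space p) {x. (\<Sum>i<j. x i) = k})
     sums prob {\<omega>\<in>space M. Z (Suc n) \<omega> = k}"
proof -
  have "{\<omega>\<in>space M. (\<lambda>i. \<xi> n i \<omega>) \<in> {x. (\<Sum>i<Z n \<omega>. x i) = k}} = {\<omega>\<in>space M. Z (Suc n) \<omega> = k}"
    by (auto simp: Z_Suc)
  with sums_prob_Z_offspring_row[of "\<lambda>j. {x. (\<Sum>i<j. x i) = k}" n, OF iid_sum_event] show ?thesis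
    by simp
qed

text \<open>This is the monotonicity in n of the normalised probabilities. The laws of successive
  generations arise from one another by the same nonnegative transition kernel, so the inequality
  between generations 0 and 1 propagates; there it only says that \<open>Z 1\<close> equals 1 with
  probability \<open>pmf p 1\<close>.\<close>

lemma prob_Z_Suc_ge:
  "pmf p 1 * prob {\<omega>\<in>space M. Z n \<omega> = k} \<le> prob {\<omega>\<in>space M. Z (Suc n) \<omega> = k}"
proof (induction n arbitrary: k)
  case 0
  show ?case
  proof (cases "k = 1")
    case True
    have "pmf p 1 * prob {\<omega>\<in>space M. Z 0 \<omega> = k} \<le> pmf p 1" by (simp add: mult_left_le)
    also have "\<dots> = prob {\<omega>\<in>space M. Z (Suc 0) \<omega> = k}"
      using prob_Z_1[of "{1}"] True by (simp add: measure_pmf_single)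
    finally show ?thesis .
  next
    case False
    then have empty: "{\<omega>\<in>space M. Z 0 \<omega> = k} = {}" by (auto simp: Z_0)
    show ?thesis unfolding empty by simp
  qed
next
  case (Suc n)
  show ?case
  proof (rule sums_le[OF _ sums_mult[OF prob_Z_Suc_sums] prob_Z_Suc_sums])
    fix j
    show "pmf p 1 * (prob {\<omega>\<in>space M. Z n \<omega> = j} * measure (iid_space p) {x. (\<Sum>i<j. x i) = k})
        \<le> prob {\<omega>\<in>space M. Z (Suc n) \<omega> = j} * measure (iid_space p) {x. (\<Sum>i<j. x i) = k}"
      using mult_right_mono[OF Suc[of j] measure_nonneg] by (simp add: mult.assoc)
  qed
qed

lemma \<phi>_eq_lessThan:
  "\<phi> p k \<epsilon> = measure (iid_space p)
     {x. \<bar>1 / real k * real (\<Sum>i<k. x i) - offspring_mean p\<bar> \<ge> \<epsilon>}"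
proof -
  let ?A = "{x. \<bar>1 / real k * real (\<Sum>i<k. x i) - offspring_mean p\<bar> \<ge> \<epsilon>}"
  have "(\<Sum>i=1..k. real (x i)) = real (\<Sum>i<k. x (Suc i))" for x :: "nat \<Rightarrow> nat"
    using sum.atLeast1_atMost_eq[of "\<lambda>i. real (x i)" k] by simp
  then have "\<phi> p k \<epsilon> = measure (iid_space p) {x. (\<lambda>i. x (Suc i)) \<in> ?A}"
    by (simp add: \<phi>_def)
  also have "\<dots> = measure (iid_space p) ?A" by (intro iid_space_shift iid_sum_event)
  finally show ?thesis .
qed

lemma prob_ratio_sums:
  "(\<lambda>k. prob {\<omega>\<in>space M. Z n \<omega> = k} * \<phi> p k \<epsilon>)
     sums prob {\<omega>\<in>space M. \<bar>real (Z (Suc n) \<omega>) / real (Z n \<omega>) - offspring_mean p\<bar> \<ge> \<epsilon>}"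
proof -
  let ?B = "\<lambda>k. {x. \<bar>1 / real k * real (\<Sum>i<k. x i) - offspring_mean p\<bar> \<ge> \<epsilon>}"
  have "{\<omega>\<in>space M. (\<lambda>i. \<xi> n i \<omega>) \<in> ?B (Z n \<omega>)}
      = {\<omega>\<in>space M. \<bar>real (Z (Suc n) \<omega>) / real (Z n \<omega>) - offspring_mean p\<bar> \<ge> \<epsilon>}"
    \<comment> \<open>For \<open>Z n \<omega> = 0\<close> both sides contain a division by 0 with
      value 0, so the two events agree there as well.\<close>
    by (auto simp: Z_Suc)
  with sums_prob_Z_offspring_row[of ?B n, OF iid_sum_event] show ?thesis
    by (simp add: \<phi>_eq_lessThan)
qed

end

section \<open>The limit theorem\<close>

text \<open>Monotone convergence for series. The bound on partial sums survives the limit in n, so l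
  is summable; by monotonicity l also dominates every \<open>c n\<close>, and Tannery's theorem
  applies.\<close>

lemma increasing_series_tendsto:
  fixes c :: "nat \<Rightarrow> nat \<Rightarrow> real"
  assumes nonneg: "\<And>n k. 0 \<le> c n k" and mono: "\<And>n k. c n k \<le> c (Suc n) k"
    and bound: "\<And>n N. (\<Sum>k<N. c n k) \<le> B"
    and sums: "\<And>n. (\<lambda>k. c n k) sums S n" and lim: "\<And>k. (\<lambda>n. c n k) \<longlonglongrightarrow> l k"
  shows "summable l" and "S \<longlonglongrightarrow> suminf l"
proof -
  have c_le: "c n k \<le> l k" for n k
    using lim by (intro incseq_le) (auto intro: incseq_SucI mono)
  then have l0: "0 \<le> l k" for k using nonneg order_trans by blast
  have "(\<Sum>k<N. l k) \<le> B" for N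
    by (rule LIMSEQ_le_const2[OF tendsto_sum[OF lim]]) (use bound in auto)
  then show l: "summable l" by (intro summableI_nonneg_bounded l0)
  have "\<forall>\<^sub>F (k, n) in at_top \<times>\<^sub>F sequentially. norm (c n k) \<le> l k"
    using c_le nonneg by (intro always_eventually) auto
  from tannerys_theorem[where a = "\<lambda>k n. c n k", OF lim this l]
  have "(\<lambda>n. \<Sum>k. c n k) \<longlonglongrightarrow> suminf l" by simp
  moreover have "(\<lambda>n. \<Sum>k. c n k) = S" using sums by (simp add: fun_eq_iff sums_iff)
  ultimately show "S \<longlonglongrightarrow> suminf l" by simp
qed

context galton_watson
begin

lemma prob_Z_eq_0:
  assumes p0: "pmf p 0 = 0"
  shows "prob {\<omega>\<in>space M. Z n \<omega> = 0} = 0"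
proof -
  have "emeasure M {\<omega>\<in>space M. Z n \<omega> = 0} = (\<integral>\<^sup>+ \<omega>. indicator {\<omega>\<in>space M. Z n \<omega> = 0} \<omega> \<partial>M)"
    by (rule nn_integral_indicator[symmetric]) measurable
  \<comment> \<open>As \<open>0 ^ 0 = 1\<close>, the indicator of extinction is the generating
    function's integrand at s = 0.\<close>
  also have "\<dots> = (\<integral>\<^sup>+ \<omega>. ennreal (0 ^ Z n \<omega>) \<partial>M)"
    by (intro nn_integral_cong) (auto simp: indicator_def)
  also have "\<dots> = ennreal ((pgf p ^^ n) 0)" by (rule nn_integral_Z_power[OF p0]) auto
  also have "(pgf p ^^ n) 0 = 0" using pgf_iter_bounds[OF p0, of 0 n] by simp
  finally show ?thesis by (simp add: emeasure_eq_measure)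
qed

lemma sum_prob_Z: "(\<Sum>k\<le>y. prob {\<omega>\<in>space M. Z n \<omega> = k}) = prob {\<omega>\<in>space M. Z n \<omega> \<le> y}"
proof -
  have "(\<Sum>k\<le>y. prob {\<omega>\<in>space M. Z n \<omega> = k}) = prob (\<Union>k\<le>y. {\<omega>\<in>space M. Z n \<omega> = k})"
    by (rule finite_measure_finite_Union[symmetric]) (auto simp: disjoint_family_on_def)
  also have "(\<Union>k\<le>y. {\<omega>\<in>space M. Z n \<omega> = k}) = {\<omega>\<in>space M. Z n \<omega> \<le> y}" by auto
  finally show ?thesis .
qed

lemma weighted_prob_Z_growth:
  fixes \<gamma> :: real
  assumes p0: "pmf p 0 = 0" and p1: "0 < pmf p 1" "pmf p 1 < 1"
    and \<gamma>: "0 < \<gamma>" "\<gamma> < 1" and m: "offspring_mean p > 1"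
    and p1m: "pmf p 1 = offspring_mean p powr (- \<gamma>)"
    and int1: "integrable (measure_pmf p) real"
    and int2: "integrable (measure_pmf p) (\<lambda>k. real k powr (1 + \<gamma>))"
  shows "\<exists>C>0. \<forall>n. \<forall>y\<ge>1.
           (\<Sum>k\<le>y. prob {\<omega>\<in>space M. Z n \<omega> = k} / pmf p 1 ^ n) \<le> C * real y powr \<gamma>"
proof -
  obtain C where C: "C > 0"
    "\<And>n x. x \<ge> 1 \<Longrightarrow> (pgf p ^^ n) (1 - 1 / (2 * x)) \<le> C * pmf p 1 ^ n * x powr \<gamma>"
    using pgf_iter_growth[OF p0 p1 \<gamma> m p1m int1 int2] by blast
  have "(\<Sum>k\<le>y. prob {\<omega>\<in>space M. Z n \<omega> = k} / pmf p 1 ^ n) \<le> (2 * C) * real y powr \<gamma>"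
    if y: "y \<ge> 1" for n y
  proof -
    have "prob {\<omega>\<in>space M. Z n \<omega> \<le> y} \<le> 2 * (pgf p ^^ n) (1 - 1 / (2 * real y))"
      by (rule prob_Z_le[OF p0 y])
    also have "\<dots> \<le> 2 * (C * pmf p 1 ^ n * real y powr \<gamma>)"
      using y by (intro mult_left_mono C) auto
    finally have "prob {\<omega>\<in>space M. Z n \<omega> \<le> y} / pmf p 1 ^ n \<le> 2 * C * real y powr \<gamma>"
      using p1 by (simp add: pos_divide_le_eq mult_ac)
    then show ?thesis by (simp only: sum_divide_distrib[symmetric] sum_prob_Z)
  qed
  with C show ?thesis by (intro exI[of _ "2 * C"]) auto
qed

text \<open>Finitely many small k are handled by \<open>\<phi> p k \<epsilon> \<le> 1\<close> and
  the growth bound. For the others \<open>\<phi>\<close> is replaced by a truncated moment;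
  exchanging the finite sum with the expectation lets \<open>sum_mult_min_le\<close> act for each
  value x of the offspring variable, and the moment of order 1 + \<gamma> remains.\<close>

lemma weighted_\<phi>_sum_bounded:
  fixes \<gamma> \<epsilon> :: real
  assumes p0: "pmf p 0 = 0" and p1: "0 < pmf p 1" "pmf p 1 < 1"
    and \<gamma>: "0 < \<gamma>" "\<gamma> < 1" and m: "offspring_mean p > 1"
    and p1m: "pmf p 1 = offspring_mean p powr (- \<gamma>)"
    and int1: "integrable (measure_pmf p) real"
    and int2: "integrable (measure_pmf p) (\<lambda>k. real k powr (1 + \<gamma>))" and \<epsilon>: "\<epsilon> > 0"
  shows "\<exists>B. \<forall>n N. (\<Sum>k<N. prob {\<omega>\<in>space M. Z n \<omega> = k} / pmf p 1 ^ n * \<phi> p k \<epsilon>) \<le> B"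
proof -
  define a where "a = (\<lambda>n k. prob {\<omega>\<in>space M. Z n \<omega> = k} / pmf p 1 ^ n)"
  have a0: "a n k \<ge> 0" for n k using p1 by (simp add: a_def)
  obtain C where C: "C > 0" and growth: "\<And>n y. y \<ge> 1 \<Longrightarrow> (\<Sum>k\<le>y. a n k) \<le> C * real y powr \<gamma>"
    using weighted_prob_Z_growth[OF p0 p1 \<gamma> m p1m int1 int2] unfolding a_def by blast
  define w :: "nat \<Rightarrow> nat \<Rightarrow> real" where "w = (\<lambda>k x. min (real k) ((real x)\<^sup>2 / real k))"
  define K where "K = 1 + 4 / \<epsilon>\<^sup>2"
  have K: "K \<ge> 0" by (simp add: K_def)
  obtain k0 where k0: "\<And>k. k \<ge> k0 \<Longrightarrow> \<phi> p k \<epsilon> \<le> K * measure_pmf.expectation p (w k)"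
    using \<phi>_le_truncated[OF int1 \<epsilon>] unfolding K_def w_def by blast
  have intw: "integrable (measure_pmf p) (w k)" for k
    unfolding w_def by (rule integrable_min_square)
  have w0: "w k x \<ge> 0" for k x by (simp add: w_def)
  define C' where "C' = 2 * C / (1 - 2 powr (\<gamma> - 1))"
  \<comment> \<open>At least 1 because the growth bound starts there, at least \<open>k0\<close> so
    that the estimate of \<open>\<phi>\<close> holds beyond y.\<close>
  define y where "y = max 1 k0"
  define B where "B = C * real y powr \<gamma>
    + K * (C' * measure_pmf.expectation p (\<lambda>x. real x powr (1 + \<gamma>)))"
  have "(\<Sum>k<N. a n k * \<phi> p k \<epsilon>) \<le> B" for n N
  proof -
    have "a n k * \<phi> p k \<epsilon> \<le> a n k * of_bool (k \<le> y) + K * (a n k * measure_pmf.expectation p (w k))" for k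
    proof (cases "k \<le> y")
      case True
      interpret iid: prob_space "iid_space p" by (rule prob_space_iid_space)
      have "a n k * \<phi> p k \<epsilon> \<le> a n k * 1"
        using a0 unfolding \<phi>_def by (intro mult_left_mono iid.prob_le_1)
      moreover have "0 \<le> K * (a n k * measure_pmf.expectation p (w k))"
        using K a0 w0 by (intro mult_nonneg_nonneg Bochner_Integration.integral_nonneg) auto
      ultimately show ?thesis using True by simp
    next
      case False
      then have "a n k * \<phi> p k \<epsilon> \<le> a n k * (K * measure_pmf.expectation p (w k))"
        using a0 by (intro mult_left_mono k0) (auto simp: y_def)
      then show ?thesis using False by (simp add: mult_ac)
    qed
    then have "(\<Sum>k<N. a n k * \<phi> p k \<epsilon>)
        \<le> (\<Sum>k<N. a n k * of_bool (k \<le> y)) + K * (\<Sum>k<N. a n k * measure_pmf.expectation p (w k))"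
      unfolding sum_distrib_left sum.distrib[symmetric] by (intro sum_mono)
    also have "\<dots> \<le> B" unfolding B_def
    proof (intro add_mono mult_left_mono K)
      have "(\<Sum>k<N. a n k * of_bool (k \<le> y)) = (\<Sum>k\<in>{..<N} \<inter> {..y}. a n k)"
        by (intro sum.mono_neutral_cong_right) auto
      also have "\<dots> \<le> (\<Sum>k\<le>y. a n k)" using a0 by (intro sum_mono2) auto
      also have "\<dots> \<le> C * real y powr \<gamma>" by (rule growth) (simp add: y_def)
      finally show "(\<Sum>k<N. a n k * of_bool (k \<le> y)) \<le> C * real y powr \<gamma>" .
      have "(\<Sum>k<N. a n k * measure_pmf.expectation p (w k))
          = measure_pmf.expectation p (\<lambda>x. \<Sum>k<N. a n k * w k x)"
        using intw by (subst Bochner_Integration.integral_sum) auto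
      also have "\<dots> \<le> measure_pmf.expectation p (\<lambda>x. C' * real x powr (1 + \<gamma>))"
        using sum_mult_min_le[of "a n" C \<gamma>] a0 C \<gamma>(2) growth int2 intw
        by (intro integral_mono Bochner_Integration.integrable_sum integrable_mult_right)
           (auto simp: w_def C'_def)
      finally show "(\<Sum>k<N. a n k * measure_pmf.expectation p (w k))
          \<le> C' * measure_pmf.expectation p (\<lambda>x. real x powr (1 + \<gamma>))" by simp
    qed
    finally show ?thesis .
  qed
  then show ?thesis unfolding a_def by blast
qed

lemma ratio_large_deviation:
  fixes \<gamma> \<epsilon> :: real
  defines "m \<equiv> offspring_mean p"
  assumes p0: "pmf p 0 = 0" and p1: "0 < pmf p 1" "pmf p 1 < 1"
    and \<gamma>: "0 < \<gamma>" "\<gamma> < 1" and m: "m > 1" and p1m: "pmf p 1 = m powr (- \<gamma>)"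
    and int1: "integrable (measure_pmf p) real"
    and int2: "integrable (measure_pmf p) (\<lambda>k. real k powr (1 + \<gamma>))" and \<epsilon>: "\<epsilon> > 0"
  shows "(\<lambda>k. q_limit M p Z \<gamma> k * \<phi> p k \<epsilon>) summable_on {1..}"
    and "(\<lambda>n. m powr (\<gamma> * real n) *
            prob {\<omega> \<in> space M. \<bar>real (Z (Suc n) \<omega>) / real (Z n \<omega>) - m\<bar> \<ge> \<epsilon>})
           \<longlonglongrightarrow> (\<Sum>\<^sub>\<infinity>k\<in>{1..}. q_limit M p Z \<gamma> k * \<phi> p k \<epsilon>)"
proof -
  note hyps = p0 p1 \<gamma> m[unfolded m_def] p1m[unfolded m_def] int1 int2
  have mp: "m powr (\<gamma> * real n) = 1 / pmf p 1 ^ n" for n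
    using m unfolding p1m inverse_eq_divide[symmetric]
    by (simp add: powr_realpow[symmetric] powr_powr powr_minus[symmetric])
  define a where "a = (\<lambda>n k. prob {\<omega>\<in>space M. Z n \<omega> = k} / pmf p 1 ^ n)"
  have a0: "a n k \<ge> 0" for n k using p1 by (simp add: a_def)
  have amono: "a n k \<le> a (Suc n) k" for n k
    using prob_Z_Suc_ge[of n k] p1 by (simp add: a_def field_simps)
  obtain C where growth: "\<And>n y. y \<ge> 1 \<Longrightarrow> (\<Sum>k\<le>y. a n k) \<le> C * real y powr \<gamma>"
    using weighted_prob_Z_growth[OF hyps] unfolding a_def by blast
  \<comment> \<open>\<open>q_limit\<close> is defined by \<open>lim\<close>, so convergence has to
    be established: the sequence is nondecreasing, and the growth bound for partial sums also bounds
    each single term.\<close>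
  have alim: "(\<lambda>n. a n k) \<longlonglongrightarrow> q_limit M p Z \<gamma> k" for k
  proof -
    have "a n k \<le> C * real (max 1 k) powr \<gamma>" for n
    proof -
      have "a n k \<le> (\<Sum>j\<le>max 1 k. a n j)" using a0 by (intro member_le_sum) auto
      also have "\<dots> \<le> C * real (max 1 k) powr \<gamma>" by (rule growth) simp
      finally show ?thesis .
    qed
    then have "\<exists>l. (\<lambda>n. a n k) \<longlonglongrightarrow> l"
      by (metis incseq_convergent incseq_SucI amono)
    then obtain l where "(\<lambda>n. a n k) \<longlonglongrightarrow> l" ..
    moreover have "a n k = prob {\<omega>\<in>space M. Z n \<omega> = k} * offspring_mean p powr (\<gamma> * real n)" for n
      using mp[of n] by (simp add: a_def m_def)
    ultimately show ?thesis by (simp add: q_limit_def limI)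
  qed
  obtain B where B: "\<And>n N. (\<Sum>k<N. a n k * \<phi> p k \<epsilon>) \<le> B"
    using weighted_\<phi>_sum_bounded[OF hyps \<epsilon>] unfolding a_def by blast
  define R where "R = (\<lambda>n. m powr (\<gamma> * real n) *
            prob {\<omega> \<in> space M. \<bar>real (Z (Suc n) \<omega>) / real (Z n \<omega>) - m\<bar> \<ge> \<epsilon>})"
  have \<phi>0: "\<phi> p k \<epsilon> \<ge> 0" for k by (simp add: \<phi>_def)
  have Rsums: "(\<lambda>k. a n k * \<phi> p k \<epsilon>) sums R n" for n
    using sums_mult[OF prob_ratio_sums[of n \<epsilon>, folded m_def], of "m powr (\<gamma> * real n)"]
    by (simp add: a_def R_def mp)
  define l where "l = (\<lambda>k. q_limit M p Z \<gamma> k * \<phi> p k \<epsilon>)"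
  have llim: "(\<lambda>n. a n k * \<phi> p k \<epsilon>) \<longlonglongrightarrow> l k" for k
    unfolding l_def by (intro tendsto_mult alim tendsto_const)
  have nonneg: "0 \<le> a n k * \<phi> p k \<epsilon>" and mono: "a n k * \<phi> p k \<epsilon> \<le> a (Suc n) k * \<phi> p k \<epsilon>" for n k
    using a0 \<phi>0 amono by (simp_all add: mult_right_mono)
  note l = increasing_series_tendsto[OF nonneg mono B Rsums llim]
  have l0: "l k \<ge> 0" for k
    by (rule LIMSEQ_le_const[OF llim]) (use a0 \<phi>0 in auto)
  \<comment> \<open>The series so far starts at k = 0, the claim at k = 1. The extra term vanishes
    because extinction has probability 0.\<close>
  have "(\<lambda>n. a n 0) = (\<lambda>_. 0)" using prob_Z_eq_0[OF p0] by (simp add: a_def)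
  then have "q_limit M p Z \<gamma> 0 = 0" using alim[of 0] by (simp add: LIMSEQ_const_iff)
  then have lz: "l 0 = 0" by (simp add: l_def)
  have "(l has_sum suminf l) UNIV"
    using l(1) l0 by (intro sums_nonneg_imp_has_sum) (auto intro: summable_sums)
  then have hs: "(l has_sum suminf l) {1..}"
    by (subst has_sum_cong_neutral[where T = UNIV and g = l]) (use lz in \<open>auto simp: not_le\<close>)
  show "(\<lambda>k. q_limit M p Z \<gamma> k * \<phi> p k \<epsilon>) summable_on {1..}"
    using hs unfolding l_def summable_on_def by blast
  show "(\<lambda>n. m powr (\<gamma> * real n) *
            prob {\<omega> \<in> space M. \<bar>real (Z (Suc n) \<omega>) / real (Z n \<omega>) - m\<bar> \<ge> \<epsilon>})
           \<longlonglongrightarrow> (\<Sum>\<^sub>\<infinity>k\<in>{1..}. q_limit M p Z \<gamma> k * \<phi> p k \<epsilon>)"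
    using l(2) infsumI[OF hs] unfolding R_def l_def by simp
qed

end

theorem corollary1p14:
  fixes M :: "'a measure" and p :: "nat pmf"
    and \<xi> :: "nat \<Rightarrow> nat \<Rightarrow> 'a \<Rightarrow> nat" and Z :: "nat \<Rightarrow> 'a \<Rightarrow> nat"
    and m \<gamma> \<beta> \<epsilon> :: real and b s L :: "real \<Rightarrow> real" and \<nu> :: "real measure"
  defines "m \<equiv> offspring_mean p"
  assumes GW: "galton_watson M p \<xi> Z"
    and p0: "pmf p 0 = 0" and p1: "0 < pmf p 1" "pmf p 1 < 1"
    and finite_mean: "integrable (measure_pmf p) real" and m_gt_1: "m > 1"
    and ZlogZ: "integrable M (\<lambda>\<omega>. real (Z 1 \<omega>) * ln (real (Z 1 \<omega>)))"
    and schroeder: "\<gamma> > 0" "pmf p 1 = m powr (- \<gamma>)"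
    and b_cont: "continuous_on {0..} b" and b_mono: "mono_on {0..} b"
    and b_onto: "b ` {0..} = {0..}" and b_0: "b 0 = 0"
    and b_eq: "\<And>x. x > 0 \<Longrightarrow> b x = x powr (1 / \<beta>) * s x"
    and s_sv: "slowly_varying s"
    and s_liminf: "Liminf at_top (\<lambda>x. ereal (s x)) > 0"
    and stable: "strictly_stable \<beta> \<nu>"
    and attraction: "weak_conv_m (normed_centered_sum_law p b) \<nu>"
    and L_sv: "slowly_varying L"
    and \<beta>: "1 < \<beta>" "\<beta> < 2"
    and tail: "(\<lambda>x. measure M {\<omega> \<in> space M. real (Z 1 \<omega>) > x})
                 \<sim>[at_top] (\<lambda>x. x powr (- \<beta>) * L x)"
    and moment: "\<gamma> < \<beta> - 1 \<or> integrable M (\<lambda>\<omega>. real (Z 1 \<omega>) powr (1 + \<gamma>))"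
    and \<epsilon>: "\<epsilon> > 0"
  shows "(\<lambda>k. q_limit M p Z \<gamma> k * \<phi> p k \<epsilon>) summable_on {1..} \<and>
         (\<lambda>n. m powr (\<gamma> * real n) *
            measure M {\<omega> \<in> space M. \<bar>real (Z (Suc n) \<omega>) / real (Z n \<omega>) - m\<bar> \<ge> \<epsilon>})
           \<longlonglongrightarrow> (\<Sum>\<^sub>\<infinity>k\<in>{1..}. q_limit M p Z \<gamma> k * \<phi> p k \<epsilon>)"
proof -
  interpret galton_watson M p \<xi> Z by (rule GW)
  define F where "F = (\<lambda>x. measure_pmf.prob p {k. x < real k})"
  have "(\<lambda>x. measure M {\<omega> \<in> space M. real (Z 1 \<omega>) > x}) = F"
    using prob_Z_1[of "{k. _ < real k}"] by (simp add: F_def fun_eq_iff)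
  note doubling = regularly_varying_doubling[OF L_sv tail[unfolded this]]
  have "integrable (measure_pmf p) (\<lambda>k. real k powr (1 + \<gamma>))"
    using moment
  proof
    assume "\<gamma> < \<beta> - 1"
    then show ?thesis
      using moment_finite_of_tail[OF doubling[unfolded F_def], of "1 + \<gamma>"] schroeder by simp
  next
    assume "integrable M (\<lambda>\<omega>. real (Z 1 \<omega>) powr (1 + \<gamma>))"
    then show ?thesis by (rule integrable_Z_1_iff[THEN iffD1])
  qed
  \<comment> \<open>If \<gamma> were at least 1, then \<open>1 + \<gamma> \<ge> 2 > \<beta>\<close>,
    and a tail of index \<beta> would make the moment just obtained infinite.\<close>
  moreover from this have "\<gamma> < 1"
    using moment_infinite_of_tail[OF doubling[unfolded F_def], of "1 + \<gamma>"] schroeder \<beta> by force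
  ultimately show ?thesis
    using ratio_large_deviation[OF p0 p1 schroeder(1) _ m_gt_1[unfolded m_def] schroeder(2)[unfolded m_def]
        finite_mean _ \<epsilon>]
    unfolding m_def by blast
qed

end
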